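(* Let $T=(1,2,\ldots,d,t_d,t_{d+1},\ldots,t_{\mathsf j},0)$ with $d\ge t_d\ge t_{d+1}\ge\cdots\ge t_{\mathsf j}>0$, and let $P$ be a partition of diagonal lengths $T$, with component partitions $P_d,\ldots,P_{\mathsf j}$. Then the morphism $$\pi:\mathbb V(E_P)\longrightarrow \prod_{i=d}^{\mathsf j}\mathbb V(E_{P_i}),\qquad I\mapsto \Big(\big\langle \tilde s_i\big(pr_1(I\cap W_i)\big)\big\rangle+\mathfrak m^{d_i+1}\Big)_{i=d,\ldots,\mathsf j}$$ is an isomorphism from the Jordan cell $\mathbb V(E_P)$ onto $\prod_{i=d}^{\mathsf j}\mathbb V(E_{P_i})$.
   Context: Let $R=\mathsf k[x,y]$ with its standard grading over an arbitrary field $\mathsf k$, $\mathfrak m=(x,y)$, $R_i$ the space of forms of degree $i$. For a partition $P=(p_1\ge p_2\ge\cdots\ge p_t)$ let $C_P$ be the set of monomials $x^ay^b$ with $0\le b<t$, $0\le a<p_{b+1}$ (the Ferrers diagram: $x$-degree increases to the right, $y$-degree increases downwards), and let $E_P$ be the set of monomials not in $C_P$, and also the monomial ideal they generate. $(C_P)_i$ is the set of degree-$i$ monomials in $C_P$. The diagonal lengths of $P$ is the Hilbert function of $R/E_P$. Put $t_{d-1}=d$, $t_{\mathsf j+1}=0$, $\delta_i=t_{i-1}-t_i$ for $d\le i\le \mathsf j+1$. Monomials of degree $i$ are ordered $x^i<x^{i-1}y<\cdots<y^i$ (lex; "first" and "above" mean smaller $y$-degree). The initial monomial of a form is its monomial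 of highest $y$-degree with nonzero coefficient; $\mathrm{in}(I)$ is the ideal generated by the initial monomials of the elements of $I$. The Jordan cell $\mathbb V(E_P)$ is the affine variety parametrizing all graded ideals $I\subset R$ with $\mathrm{in}(I)=E_P$. Component partitions. A monomial $x^ay^b\in E_P$ is a horizontal-border monomial if $b>0$ and $x^ay^{b-1}\notin E_P$; it is a vertical-border monomial if $a>0$ and $x^{a-1}y^b\notin E_P$. $A(P)_i$ is the set of degree-$i$ horizontal-border monomials. A degree-$i$ hand monomial is a degree-$i$ monomial $\nu\in C_P$ with $x\nu\in E_P$. For $d\le i\le\mathsf j$: $V_{i1}=A(P)_i$ if $x^i\in C_P$; if $x^i\notin C_P$, then $V_{i1}=A(P)_i\cup\{x^ay^b\}$ where $x^ay^b$ is the last (lex) degree-$i$ vertical-border monomial lying above the first (lex) monomial of $A(P)_i$ (the condition "above" being vacuous if $A(P)_i=\emptyset$). One has $|V_{i1}|=\delta_i+1$. $V_{i2}$ is the set of the first (lex) $\delta_{i+1}$ degree-$i$ hand monomials. Let $V_i$ be the span of $V_{i1}\cup V_{i2}$, $d_i=\delta_i+\delta_{i+1}$ (so $\dim V_i=d_i+1$), let $s_i$ be the unique order-preserving bijection from $V_{i1}\cup V_{i2}$ to the set of degree-$d_i$ monomials of $R$, and let $\tilde s_i:V_i\to R_{d_i}$ be the induced linear isomorphism. The component $P_i$ is the unique partition with $E_{P_i}=\langle s_i(V_{i1})\rangle+\mathfrak m^{d_i+1}$; its diagonal lengths are $T_i=(1,2,\ldots,d_i,\delta_{i+1},0)$ (if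 $d_i=0$, $P_i$ is empty and $E_{P_i}=R$). Let $W_i$ be the span of $V_{i1}\cup (C_P)_i$ and $K_i$ the span of $(C_P)_i\setminus V_{i2}$, so $W_i=V_i\oplus K_i$; $pr_1:W_i\to V_i$ is the projection along $K_i$. For $I\in\mathbb V(E_P)$, $pr_1(I\cap W_i)$ is a $(\delta_i+1)$-dimensional subspace of $V_i$. *)

theory Defs
  imports
    Complex_Main
    "HOL-Library.Poly_Mapping"
    "HOL-Library.Product_Plus"
    "HOL-Library.Set_Algebras"
    "HOL-Library.FuncSet"
begin

section \<open>The polynomial ring in two variables\<close>

text \<open>The pair \<open>(a, b)\<close> stands for the monomial \<open>x^a y^b\<close>; monomials multiply by adding pairs.
  Among monomials of one degree the order \<open>x^i < x^(i-1) y < \<dots> < y^i\<close> is the order of the second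
  components, so it is always written as a comparison of \<open>snd\<close>.\<close>

type_synonym monom2 = "nat \<times> nat"
type_synonym 'k poly2 = "monom2 \<Rightarrow>\<^sub>0 'k"

definition deg :: "monom2 \<Rightarrow> nat" where
  "deg m = fst m + snd m"

definition monoms :: "nat \<Rightarrow> monom2 set" where
  "monoms i = {m. deg m = i}"

definition mon :: "monom2 \<Rightarrow> 'k::comm_ring_1 poly2" where
  "mon m = Poly_Mapping.single m 1"

definition scale :: "'k::comm_ring_1 \<Rightarrow> 'k poly2 \<Rightarrow> 'k poly2" where
  "scale c f = Poly_Mapping.single 0 c * f"

global_interpretation lin: vector_space "scale :: 'k::field \<Rightarrow> 'k poly2 \<Rightarrow> 'k poly2"
  defines lin_span = lin.span and lin_dim = lin.dim
proof
  fix a b :: 'k and x y :: "'k poly2"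
  show "scale a (x + y) = scale a x + scale a y" by (simp add: scale_def algebra_simps)
  show "scale (a + b) x = scale a x + scale b x"
    by (simp add: scale_def Poly_Mapping.single_add algebra_simps)
  show "scale a (scale b x) = scale (a * b) x"
    by (simp add: scale_def Poly_Mapping.mult_single mult.assoc[symmetric])
  show "scale 1 x = x" by (simp add: scale_def)
qed

text \<open>Ideals are the submodules of the ring over itself.\<close>

global_interpretation idl: module "(*) :: 'r::comm_ring_1 \<Rightarrow> 'r \<Rightarrow> 'r"
  defines is_ideal = idl.subspace and ideal_gen = idl.span
  by unfold_locales (simp_all add: algebra_simps)

text \<open>The part of \<open>f\<close> supported on a set of monomials: the projection onto the span of \<open>S\<close> along
  the span of the complementary monomials.\<close>

definition restr :: "monom2 set \<Rightarrow> 'k::comm_ring_1 poly2 \<Rightarrow> 'k poly2" where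
  "restr S f = (\<Sum>m \<in> Poly_Mapping.keys f \<inter> S. Poly_Mapping.single m (Poly_Mapping.lookup f m))"

definition forms :: "nat \<Rightarrow> 'k::comm_ring_1 poly2 set" where
  "forms i = {f. Poly_Mapping.keys f \<subseteq> monoms i}"

definition graded_ideal :: "'k::field poly2 set \<Rightarrow> bool" where
  "graded_ideal I \<longleftrightarrow> is_ideal I \<and> (\<forall>f\<in>I. \<forall>i. restr (monoms i) f \<in> I)"

definition max_ideal :: "'k::field poly2 set" where
  "max_ideal = ideal_gen {mon (1, 0), mon (0, 1)}"

primrec ideal_power :: "'r::comm_ring_1 set \<Rightarrow> nat \<Rightarrow> 'r set" where
  "ideal_power I 0 = UNIV"
| "ideal_power I (Suc n) = ideal_gen {f * g | f g. f \<in> I \<and> g \<in> ideal_power I n}"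

text \<open>The dimension of the degree \<open>i\<close> part of the quotient by \<open>I\<close>.\<close>

definition hilbert_function :: "'k::field poly2 set \<Rightarrow> nat \<Rightarrow> nat" where
  "hilbert_function I i = lin_dim (forms i :: 'k poly2 set) - lin_dim (I \<inter> forms i)"

text \<open>Only meaningful for a nonzero form, where the monomial of highest \<open>y\<close>-degree is unique.\<close>

definition initial_monomial :: "'k::field poly2 \<Rightarrow> monom2" where
  "initial_monomial f = arg_max_on snd (Poly_Mapping.keys f)"

definition initial_ideal :: "'k::field poly2 set \<Rightarrow> 'k poly2 set" where
  "initial_ideal I = ideal_gen {mon (initial_monomial f) | f. f \<in> I \<and> f \<noteq> 0 \<and> (\<exists>i. f \<in> forms i)}"


section \<open>Partitions and their Jordan cells\<close>

text \<open>The list \<open>P\<close> has entries \<open>p_1 \<ge> p_2 \<ge> \<dots>\<close>, so that \<open>P ! b\<close> is \<open>p_(b+1)\<close>.\<close>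

definition is_partition :: "nat list \<Rightarrow> bool" where
  "is_partition P \<longleftrightarrow> sorted_wrt (\<ge>) P \<and> 0 \<notin> set P"

definition C_mon :: "nat list \<Rightarrow> monom2 set" where
  "C_mon P = {(a, b). b < length P \<and> a < P ! b}"

definition E_mon :: "nat list \<Rightarrow> monom2 set" where
  "E_mon P = - C_mon P"

definition E_ideal :: "nat list \<Rightarrow> 'k::field poly2 set" where
  "E_ideal P = ideal_gen (mon ` E_mon P)"

definition jordan_cell :: "nat list \<Rightarrow> 'k::field poly2 set set" where
  "jordan_cell P = {I. graded_ideal I \<and> initial_ideal I = E_ideal P}"

text \<open>The affine coordinates of the cell. The degree \<open>i\<close> part of \<open>I\<close> has a unique reduced echelon
  basis: for each \<open>m \<in> E_mon P\<close> of degree \<open>i\<close> exactly one element of \<open>I\<close> has the form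
  \<open>m + (\<Sum>c. a(m,c) c)\<close> with \<open>c\<close> running over the degree \<open>i\<close> monomials of \<open>C_mon P\<close>, and only
  \<open>c\<close> preceding \<open>m\<close> occur. The \<open>a(m,c)\<close> are the standard coordinates of the Schubert cell containing
  the degree \<open>i\<close> part of \<open>I\<close>. They embed the Jordan cell as a closed subset of an affine space, the
  equations expressing that \<open>x\<close> and \<open>y\<close> times the degree \<open>i\<close> part lie in the degree \<open>i+1\<close> part. All
  other index pairs get the value \<open>0\<close>.\<close>

definition reduced_form :: "nat list \<Rightarrow> 'k::field poly2 set \<Rightarrow> monom2 \<Rightarrow> 'k poly2" where
  "reduced_form P I m =
     (THE f. f \<in> I \<and> Poly_Mapping.lookup f m = 1 \<and>
       Poly_Mapping.keys f \<subseteq> insert m (C_mon P \<inter> monoms (deg m)))"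

definition cell_coord :: "nat list \<Rightarrow> 'k::field poly2 set \<Rightarrow> monom2 \<times> monom2 \<Rightarrow> 'k" where
  "cell_coord P I = (\<lambda>(m, c).
     if m \<in> E_mon P \<and> c \<in> C_mon P \<and> deg c = deg m \<and> snd c < snd m
     then Poly_Mapping.lookup (reduced_form P I m) c else 0)"

definition prod_coord ::
  "nat set \<Rightarrow> (nat \<Rightarrow> nat list) \<Rightarrow> (nat \<Rightarrow> 'k::field poly2 set) \<Rightarrow> nat \<times> (monom2 \<times> monom2) \<Rightarrow> 'k" where
  "prod_coord S Q J = (\<lambda>(i, v). if i \<in> S then cell_coord (Q i) (J i) v else 0)"


section \<open>Morphisms and isomorphisms over a ground field\<close>

text \<open>Polynomials over \<open>'k\<close> in variables indexed by \<open>'v\<close>, evaluated at a point with coordinates in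
  an extension field of \<open>'k\<close>.\<close>

type_synonym ('v, 'k) mpoly = "('v \<Rightarrow>\<^sub>0 nat) \<Rightarrow>\<^sub>0 'k"

definition eval_mpoly :: "('k::field \<Rightarrow> 'l::field) \<Rightarrow> ('v, 'k) mpoly \<Rightarrow> ('v \<Rightarrow> 'l) \<Rightarrow> 'l" where
  "eval_mpoly \<phi> p z =
    (\<Sum>u \<in> Poly_Mapping.keys p. \<phi> (Poly_Mapping.lookup p u) *
     (\<Prod>v \<in> Poly_Mapping.keys u. z v ^ Poly_Mapping.lookup u v))"

definition field_embedding :: "('k::field \<Rightarrow> 'l::field) \<Rightarrow> bool" where
  "field_embedding \<phi> \<longleftrightarrow>
     \<phi> 1 = 1 \<and> (\<forall>a b. \<phi> (a + b) = \<phi> a + \<phi> b) \<and> (\<forall>a b. \<phi> (a * b) = \<phi> a * \<phi> b)"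

text \<open>Varieties over \<open>'k\<close> are given by their points with values in an extension field \<open>'l\<close>, and
  morphisms are the maps given in coordinates by polynomials with coefficients in \<open>'k\<close>. For
  \<open>'l\<close> an algebraic closure of \<open>'k\<close> this is the usual notion of a morphism of affine varieties
  defined over \<open>'k\<close>; for \<open>'l = 'k\<close> and \<open>\<phi> = id\<close> it concerns the \<open>'k\<close>-rational points, which alone do
  not determine a morphism when \<open>'k\<close> is finite.\<close>

definition morphism_over ::
  "('k::field \<Rightarrow> 'l::field) \<Rightarrow> 'a set \<Rightarrow> ('a \<Rightarrow> 'v \<Rightarrow> 'l) \<Rightarrow> 'b set \<Rightarrow> ('b \<Rightarrow> 'w \<Rightarrow> 'l) \<Rightarrow> ('a \<Rightarrow> 'b) \<Rightarrow> bool"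
  where
  "morphism_over \<phi> X cX Y cY f \<longleftrightarrow> f ` X \<subseteq> Y \<and>
     (\<exists>F :: 'w \<Rightarrow> ('v, 'k) mpoly. \<forall>p\<in>X. \<forall>w. cY (f p) w = eval_mpoly \<phi> (F w) (cX p))"

definition isomorphism_over ::
  "('k::field \<Rightarrow> 'l::field) \<Rightarrow> 'a set \<Rightarrow> ('a \<Rightarrow> 'v \<Rightarrow> 'l) \<Rightarrow> 'b set \<Rightarrow> ('b \<Rightarrow> 'w \<Rightarrow> 'l) \<Rightarrow> ('a \<Rightarrow> 'b) \<Rightarrow> bool"
  where
  "isomorphism_over \<phi> X cX Y cY f \<longleftrightarrow>
     bij_betw f X Y \<and> morphism_over \<phi> X cX Y cY f \<and> morphism_over \<phi> Y cY X cX (inv_into X f)"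


section \<open>Component partitions\<close>

definition horizontal_border :: "nat list \<Rightarrow> nat \<Rightarrow> monom2 set" where
  "horizontal_border P i = {(a, b). a + b = i \<and> (a, b) \<in> E_mon P \<and> b > 0 \<and> (a, b - 1) \<notin> E_mon P}"

definition vertical_border :: "nat list \<Rightarrow> nat \<Rightarrow> monom2 set" where
  "vertical_border P i = {(a, b). a + b = i \<and> (a, b) \<in> E_mon P \<and> a > 0 \<and> (a - 1, b) \<notin> E_mon P}"

definition hands :: "nat list \<Rightarrow> nat \<Rightarrow> monom2 set" where
  "hands P i = {(a, b). a + b = i \<and> (a, b) \<in> C_mon P \<and> (a + 1, b) \<in> E_mon P}"

definition V1 :: "nat list \<Rightarrow> nat \<Rightarrow> monom2 set" where
  "V1 P i = (if (i, 0) \<in> C_mon P then horizontal_border P i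
     else insert (arg_max_on snd {v \<in> vertical_border P i. \<forall>h \<in> horizontal_border P i. snd v < snd h})
            (horizontal_border P i))"

text \<open>In what follows \<open>T\<close> is the sequence of diagonal lengths of \<open>P\<close>.\<close>

definition delta :: "(nat \<Rightarrow> nat) \<Rightarrow> nat \<Rightarrow> nat" where
  "delta T i = T (i - 1) - T i"

definition first_monoms :: "nat \<Rightarrow> monom2 set \<Rightarrow> monom2 set" where
  "first_monoms n M = {m \<in> M. card {m' \<in> M. snd m' < snd m} < n}"

definition V2 :: "(nat \<Rightarrow> nat) \<Rightarrow> nat list \<Rightarrow> nat \<Rightarrow> monom2 set" where
  "V2 T P i = first_monoms (delta T (i + 1)) (hands P i)"

definition comp_deg :: "(nat \<Rightarrow> nat) \<Rightarrow> nat \<Rightarrow> nat" where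
  "comp_deg T i = delta T i + delta T (i + 1)"

definition s_map :: "(nat \<Rightarrow> nat) \<Rightarrow> nat list \<Rightarrow> nat \<Rightarrow> monom2 \<Rightarrow> monom2" where
  "s_map T P i = (THE g. g \<in> extensional (V1 P i \<union> V2 T P i) \<and>
     bij_betw g (V1 P i \<union> V2 T P i) (monoms (comp_deg T i)) \<and>
     (\<forall>m \<in> V1 P i \<union> V2 T P i. \<forall>m' \<in> V1 P i \<union> V2 T P i. snd m < snd m' \<longrightarrow> snd (g m) < snd (g m')))"

definition s_lin :: "(nat \<Rightarrow> nat) \<Rightarrow> nat list \<Rightarrow> nat \<Rightarrow> 'k::field poly2 \<Rightarrow> 'k poly2" where
  "s_lin T P i f = (\<Sum>m \<in> Poly_Mapping.keys f. Poly_Mapping.single (s_map T P i m) (Poly_Mapping.lookup f m))"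

text \<open>The type argument supplies the field over which the defining equation of ideals is read; the
  resulting partition does not depend on it.\<close>

definition component :: "'k::field itself \<Rightarrow> (nat \<Rightarrow> nat) \<Rightarrow> nat list \<Rightarrow> nat \<Rightarrow> nat list" where
  "component _ T P i = (THE Q. is_partition Q \<and>
     (E_ideal Q :: 'k poly2 set) =
       ideal_gen (mon ` s_map T P i ` V1 P i) + ideal_power max_ideal (comp_deg T i + 1))"


section \<open>The morphism to the product of the component cells\<close>

definition W_space :: "nat list \<Rightarrow> nat \<Rightarrow> 'k::field poly2 set" where
  "W_space P i = lin_span (mon ` (V1 P i \<union> (C_mon P \<inter> monoms i)))"

text \<open>Both \<open>V_i\<close> and \<open>K_i\<close> are spanned by monomials, so projecting along \<open>K_i\<close> keeps exactly the
  terms in \<open>V1 P i \<union> V2 T P i\<close>.\<close>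

definition pr1 :: "(nat \<Rightarrow> nat) \<Rightarrow> nat list \<Rightarrow> nat \<Rightarrow> 'k::field poly2 \<Rightarrow> 'k poly2" where
  "pr1 T P i f = restr (V1 P i \<union> V2 T P i) f"

definition pi_component :: "(nat \<Rightarrow> nat) \<Rightarrow> nat list \<Rightarrow> nat \<Rightarrow> 'k::field poly2 set \<Rightarrow> 'k poly2 set" where
  "pi_component T P i I =
     ideal_gen (s_lin T P i ` pr1 T P i ` (I \<inter> W_space P i)) + ideal_power max_ideal (comp_deg T i + 1)"

end

theory Submission
  imports Defs
begin

text \<open>Write \<open>C\<close> for the monomials of the diagram of \<open>P\<close> and \<open>E\<close> for the others.

  An ideal of the Jordan cell is the same thing as its normal forms. Modulo \<open>I\<close> every monomial \<open>m\<close>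
  is congruent to exactly one combination \<open>\<Sum>c. N m c * c\<close> of monomials \<open>c \<in> C\<close> of the same degree;
  for \<open>m \<in> E\<close> only \<open>c\<close> preceding \<open>m\<close> occur, and \<open>- N m c\<close> is the coordinate \<open>(m, c)\<close> of the cell.
  A matrix \<open>N\<close> of this shape comes from an ideal if and only if normal forms are compatible with
  multiplication by each variable \<open>v\<close>, that is
  \<open>N (v m) c = (\<Sum>u\<in>C. N m u * N (v u) c)\<close>
  (\<open>nf_ideal_in_cell\<close>, \<open>is_nf_cell_nf\<close>).

  These equations can be solved. Call \<open>snd m - snd c\<close> the drop of the entry \<open>(m, c)\<close>. A product
  of two entries of positive drop in one of the equations only involves entries of smaller drop than
  the entry on the left. Up to such products the equation for \<open>x\<close> identifies \<open>(m, c)\<close> with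
  \<open>(x m, x c)\<close> whenever \<open>x c \<in> C\<close>, and the equation for \<open>y\<close> identifies \<open>(m, c)\<close> with
  \<open>(m / y, c / y)\<close> whenever \<open>m / y \<in> E\<close> (with \<open>0\<close> if \<open>y\<close> does not divide \<open>c\<close>). An entry at which
  neither move is possible has \<open>c\<close> a hand monomial and \<open>m\<close> a horizontal-border monomial; call it
  free. So all entries are polynomials in the free ones (\<open>nf_solution_unique\<close>). Conversely the free
  entries can be prescribed arbitrarily: the recursion just described defines \<open>N\<close>, it satisfies the
  equations for \<open>x\<close> by construction, and the equations for \<open>y\<close> follow by induction because the two
  ways of reducing \<open>x y m\<close> agree (\<open>nf_solution_step_y\<close>). Thus the cell is the graph of a polynomial
  map defined on the affine space of the free entries.

  In degree \<open>i\<close> the free entries are the pairs \<open>(m, c) \<in> V\<^sub>i\<^sub>1 \<times> V\<^sub>i\<^sub>2\<close> with \<open>c\<close> preceding \<open>m\<close>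
  (\<open>free_tails_eq\<close>): the extra monomial of \<open>V\<^sub>i\<^sub>1\<close> precedes all of \<open>C\<close>, and a hand monomial left out of
  \<open>V\<^sub>i\<^sub>2\<close> comes after all of \<open>E\<close>. The diagram of a component partition contains all monomials below its
  top degree, so the compatibility equations are vacuous there and the component cell is an affine space
  with coordinates \<open>(s m, s c)\<close>. The component map copies the coordinate \<open>(m, c)\<close> to the coordinate
  \<open>(s m, s c)\<close> (\<open>pi_component_coord\<close>). In coordinates \<open>\<pi>\<close> is therefore the projection of the graph
  to its base, and its inverse is given by the recursion. The recursion commutes with ring
  homomorphisms (\<open>nf_solution_hom\<close>); running it in a polynomial ring over the ground field, with
  the variables as free entries, yields the polynomials that define the inverse morphism.\<close>

section \<open>Polynomials, supports and monomial ideals\<close>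

abbreviation lookup :: "('u \<Rightarrow>\<^sub>0 'a::zero) \<Rightarrow> 'u \<Rightarrow> 'a" where "lookup \<equiv> Poly_Mapping.lookup"
abbreviation keys :: "('u \<Rightarrow>\<^sub>0 'a::zero) \<Rightarrow> 'u set" where "keys \<equiv> Poly_Mapping.keys"
abbreviation single :: "'u \<Rightarrow> 'a::zero \<Rightarrow> 'u \<Rightarrow>\<^sub>0 'a" where "single \<equiv> Poly_Mapping.single"

(* As a rewrite rule the first fact reassociates products in every commutative ring and loops
   together with mult.assoc. Without the other two, quantified monomials stay variables. *)
declare idl.scale_scale [simp del] split_paired_All [simp del] split_paired_Ex [simp del]

lemma sum_single_lookup:
  fixes f :: "'u \<Rightarrow>\<^sub>0 'a::comm_monoid_add"
  assumes "finite S" "keys f \<subseteq> S"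
  shows "(\<Sum>u\<in>S. single u (lookup f u)) = f"
proof (rule poly_mapping_eqI)
  fix k
  have "lookup (\<Sum>u\<in>S. single u (lookup f u)) k = (\<Sum>u\<in>S. if u = k then lookup f u else 0)"
    by (auto simp: lookup_sum lookup_single when_def intro!: sum.cong)
  also have "\<dots> = lookup f k"
    using assms by (auto simp: in_keys_iff)
  finally show "lookup (\<Sum>u\<in>S. single u (lookup f u)) k = lookup f k" .
qed

text \<open>If \<open>\<phi>\<close> is the identity, this extends \<open>G\<close> linearly from monomials to polynomials, which is
  how normal forms are computed. If \<open>G\<close> turns sums of exponents into products, it is evaluation of
  polynomials over \<open>\<phi>\<close>.\<close>
definition linear_ext :: "('a::zero \<Rightarrow> 'b::comm_ring_1) \<Rightarrow> ('u \<Rightarrow> 'b) \<Rightarrow> ('u \<Rightarrow>\<^sub>0 'a) \<Rightarrow> 'b" where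
  "linear_ext \<phi> G f = (\<Sum>u\<in>keys f. \<phi> (lookup f u) * G u)"

text \<open>Besides embeddings of fields this covers evaluation maps on polynomial rings, to which the
  solution of the coordinate equations will be transported.\<close>
definition ring_map :: "('a::comm_ring_1 \<Rightarrow> 'b::comm_ring_1) \<Rightarrow> bool" where
  "ring_map h \<longleftrightarrow> h 1 = 1 \<and> (\<forall>a b. h (a + b) = h a + h b) \<and> (\<forall>a b. h (a * b) = h a * h b)"

lemma ring_map_0: "ring_map h \<Longrightarrow> h 0 = 0"
  unfolding ring_map_def by (metis add_cancel_right_left)

lemma ring_map_add: "ring_map h \<Longrightarrow> h (a + b) = h a + h b"
  and ring_map_mult: "ring_map h \<Longrightarrow> h (a * b) = h a * h b"
  by (simp_all add: ring_map_def)

lemma ring_map_minus: "ring_map h \<Longrightarrow> h (- a) = - h a"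
  using ring_map_0[of h] unfolding ring_map_def by (metis add.right_inverse minus_unique)

lemma ring_map_diff: "ring_map h \<Longrightarrow> h (a - b) = h a - h b"
  using ring_map_minus[of h b] unfolding ring_map_def by (metis diff_conv_add_uminus)

lemma ring_map_sum: "ring_map h \<Longrightarrow> h (\<Sum>x\<in>S. f x) = (\<Sum>x\<in>S. h (f x))"
  by (induction S rule: infinite_finite_induct) (simp_all add: ring_map_0[of h] ring_map_add[of h])

lemma ring_map_id: "ring_map (\<lambda>a. a)"
  by (simp add: ring_map_def)

lemma linear_ext_superset:
  assumes "ring_map \<phi>" "finite S" "keys f \<subseteq> S"
  shows "linear_ext \<phi> G f = (\<Sum>u\<in>S. \<phi> (lookup f u) * G u)"
  unfolding linear_ext_def
  using assms(2,3) by (intro sum.mono_neutral_left) (auto simp: in_keys_iff ring_map_0[OF assms(1)])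

lemma linear_ext_add:
  assumes "ring_map \<phi>"
  shows "linear_ext \<phi> G (f + g) = linear_ext \<phi> G f + linear_ext \<phi> G g"
proof -
  let ?S = "keys f \<union> keys g"
  have "keys (f + g) \<subseteq> ?S" by (rule Poly_Mapping.keys_add)
  then show ?thesis
    by (simp add: linear_ext_superset[OF assms, where S = ?S] lookup_add ring_map_add[OF assms]
        distrib_right sum.distrib)
qed

lemma linear_ext_0: "linear_ext \<phi> G 0 = 0"
  by (simp add: linear_ext_def)

lemma linear_ext_single:
  "ring_map \<phi> \<Longrightarrow> linear_ext \<phi> G (single u a) = \<phi> a * G u"
  by (simp add: linear_ext_def ring_map_0[of \<phi>])

lemma linear_ext_sum:
  "ring_map \<phi> \<Longrightarrow> linear_ext \<phi> G (\<Sum>x\<in>S. f x) = (\<Sum>x\<in>S. linear_ext \<phi> G (f x))"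
  by (induction S rule: infinite_finite_induct) (auto simp: linear_ext_0 linear_ext_add)

lemma linear_ext_single_mult:
  assumes "ring_map \<phi>"
  shows "linear_ext \<phi> G (single w a * f) = \<phi> a * linear_ext \<phi> (\<lambda>u. G (w + u)) f"
proof -
  have "single w a * f = single w a * (\<Sum>u\<in>keys f. single u (lookup f u))"
    by (simp add: sum_single_lookup)
  also have "\<dots> = (\<Sum>u\<in>keys f. single (w + u) (a * lookup f u))"
    by (simp add: sum_distrib_left Poly_Mapping.mult_single)
  finally have "linear_ext \<phi> G (single w a * f) = (\<Sum>u\<in>keys f. \<phi> (a * lookup f u) * G (w + u))"
    using assms by (simp add: linear_ext_sum linear_ext_single)
  also have "\<dots> = (\<Sum>u\<in>keys f. \<phi> a * (\<phi> (lookup f u) * G (w + u)))"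
    by (intro sum.cong refl) (simp only: ring_map_mult[OF assms] mult.assoc)
  also have "\<dots> = \<phi> a * linear_ext \<phi> (\<lambda>u. G (w + u)) f"
    by (simp only: linear_ext_def sum_distrib_left)
  finally show ?thesis .
qed

lemma linear_ext_mult:
  fixes p q :: "'u::comm_monoid_add \<Rightarrow>\<^sub>0 'a::comm_ring_1"
  assumes "ring_map \<phi>" "\<And>u v. G (u + v) = G u * G v"
  shows "linear_ext \<phi> G (p * q) = linear_ext \<phi> G p * linear_ext \<phi> G q"
proof -
  have "p * q = (\<Sum>u\<in>keys p. single u (lookup p u)) * q"
    by (simp add: sum_single_lookup)
  also have "\<dots> = (\<Sum>u\<in>keys p. single u (lookup p u) * q)"
    by (simp add: sum_distrib_right)
  finally have "linear_ext \<phi> G (p * q) = (\<Sum>u\<in>keys p. \<phi> (lookup p u) * linear_ext \<phi> (\<lambda>v. G (u + v)) q)"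
    using assms(1) by (simp add: linear_ext_sum linear_ext_single_mult)
  also have "\<dots> = (\<Sum>u\<in>keys p. \<phi> (lookup p u) * (G u * linear_ext \<phi> G q))"
    by (simp add: assms(2) linear_ext_def sum_distrib_left mult_ac)
  finally show ?thesis by (simp add: linear_ext_def sum_distrib_right mult_ac)
qed

lemma lookup_single_mult_add:
  fixes f :: "'u::cancel_comm_monoid_add \<Rightarrow>\<^sub>0 'a::comm_ring_1"
  shows "lookup (single w a * f) (w + u) = a * lookup f u"
proof -
  have "lookup (single w a * f) (w + u) = lookup (single w a * (\<Sum>v\<in>keys f. single v (lookup f v))) (w + u)"
    by (simp add: sum_single_lookup)
  also have "\<dots> = (\<Sum>v\<in>keys f. if v = u then a * lookup f u else 0)"
    by (auto simp: sum_distrib_left Poly_Mapping.mult_single lookup_sum lookup_single when_def intro!: sum.cong)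
  also have "\<dots> = a * lookup f u"
    by (auto simp: in_keys_iff)
  finally show ?thesis .
qed

lemma keys_single_mult:
  fixes f :: "'u::comm_monoid_add \<Rightarrow>\<^sub>0 'a::comm_ring_1"
  shows "keys (single w a * f) \<subseteq> (+) w ` keys f"
  using keys_mult[of "single w a" f] by (auto split: if_splits)

lemma lookup_scale [simp]: "lookup (scale a f) u = a * lookup f u"
  using lookup_single_mult_add[of 0 a f u] by (simp add: scale_def)

lemma keys_scale: "keys (scale a f) \<subseteq> keys f"
  by (auto simp: in_keys_iff)

lemma keys_mon [simp]: "keys (mon m) = {m}"
  by (simp add: mon_def)

lemma lookup_mon: "lookup (mon m) u = of_bool (m = u)"
  by (simp add: mon_def lookup_single when_def)

lemma lookup_restr: "lookup (restr S f) m = (if m \<in> S then lookup f m else 0)"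
proof -
  have "lookup (restr S f) m = (\<Sum>u\<in>keys f \<inter> S. if u = m then lookup f u else 0)"
    by (auto simp: restr_def lookup_sum lookup_single when_def intro!: sum.cong)
  then show ?thesis by (auto simp: in_keys_iff)
qed

lemma keys_restr: "keys (restr S f) = keys f \<inter> S"
  by (auto simp: in_keys_iff lookup_restr split: if_splits)

subsection \<open>Ideals\<close>

lemma is_ideal_iff:
  "is_ideal I \<longleftrightarrow> 0 \<in> I \<and> (\<forall>f\<in>I. \<forall>g\<in>I. f + g \<in> I) \<and> (\<forall>p. \<forall>f\<in>I. p * f \<in> I)"
  by (auto simp: idl.subspace_def)

lemma is_ideal_sum: "is_ideal I \<Longrightarrow> (\<And>x. x \<in> S \<Longrightarrow> f x \<in> I) \<Longrightarrow> (\<Sum>x\<in>S. f x) \<in> I"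
  by (rule idl.subspace_sum)

lemma is_ideal_diff: "is_ideal I \<Longrightarrow> f \<in> I \<Longrightarrow> g \<in> I \<Longrightarrow> f - g \<in> I"
  by (rule idl.subspace_diff)

lemma is_ideal_scale: "is_ideal I \<Longrightarrow> f \<in> I \<Longrightarrow> scale a f \<in> I"
  by (simp add: is_ideal_iff scale_def)

definition supported :: "'u set \<Rightarrow> ('u \<Rightarrow>\<^sub>0 'a::zero) set" where
  "supported S = {f. keys f \<subseteq> S}"

lemma ideal_gen_mon:
  "ideal_gen (mon ` G :: 'k::field poly2 set) = supported {w + g | w g. g \<in> G}" (is "_ = supported ?S")
proof
  have "is_ideal (supported ?S :: 'k poly2 set)"
    unfolding is_ideal_iff supported_def
  proof (intro conjI ballI allI CollectI)
    fix f g :: "'k poly2" assume "f \<in> {f. keys f \<subseteq> ?S}" "g \<in> {f. keys f \<subseteq> ?S}"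
    then show "keys (f + g) \<subseteq> ?S" using Poly_Mapping.keys_add[of f g] by blast
  next
    fix p f :: "'k poly2" assume "f \<in> {f. keys f \<subseteq> ?S}"
    then have f: "keys f \<subseteq> ?S" by simp
    show "keys (p * f) \<subseteq> ?S"
    proof
      fix u assume "u \<in> keys (p * f)"
      then obtain a b where "u = a + b" "b \<in> keys f" using keys_mult[of p f] by blast
      moreover from this f obtain w g where "b = w + g" "g \<in> G" by blast
      ultimately have "u = (a + w) + g \<and> g \<in> G" by (simp add: add.assoc)
      then show "u \<in> ?S" by blast
    qed
  qed simp
  moreover have "mon ` G \<subseteq> (supported ?S :: 'k poly2 set)"
    by (force simp: supported_def)
  ultimately show "ideal_gen (mon ` G) \<subseteq> (supported ?S :: 'k poly2 set)"
    by (intro idl.span_minimal)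
next
  show "supported ?S \<subseteq> ideal_gen (mon ` G :: 'k poly2 set)"
  proof
    fix f :: "'k poly2" assume f: "f \<in> supported ?S"
    have "single u (lookup f u) \<in> ideal_gen (mon ` G)" if "u \<in> keys f" for u
    proof -
      from f that obtain w g where u: "u = w + g" and g: "g \<in> G" by (auto simp: supported_def)
      have "single u (lookup f u) = single w (lookup f u) * mon g"
        by (simp add: mon_def Poly_Mapping.mult_single u)
      then show ?thesis using g by (auto intro: idl.span_scale idl.span_base)
    qed
    then have "(\<Sum>u\<in>keys f. single u (lookup f u)) \<in> ideal_gen (mon ` G)"
      by (intro idl.span_sum)
    then show "f \<in> ideal_gen (mon ` G)" by (simp add: sum_single_lookup)
  qed
qed

lemma ideal_gen_mon_upward:
  assumes "\<And>w m. m \<in> S \<Longrightarrow> w + m \<in> S"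
  shows "ideal_gen (mon ` S :: 'k::field poly2 set) = supported S"
proof -
  have "{w + g | w g. g \<in> S} = S"
  proof (intro equalityI subsetI)
    fix m assume "m \<in> S"
    then have "m = 0 + m \<and> m \<in> S" by simp
    then show "m \<in> {w + g | w g. g \<in> S}" by blast
  qed (use assms in blast)
  then show ?thesis by (simp add: ideal_gen_mon)
qed

lemma supported_inject:
  assumes "(supported S :: 'k::field poly2 set) = supported S'"
  shows "S = S'"
proof -
  have "m \<in> S \<longleftrightarrow> mon m \<in> (supported S :: 'k poly2 set)" for m S
    by (simp add: supported_def)
  then show ?thesis using assms by blast
qed

lemma supported_plus:
  "(supported A :: 'k::field poly2 set) + supported B = supported (A \<union> B)"
proof
  show "(supported A :: 'k poly2 set) + supported B \<subseteq> supported (A \<union> B)"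
    using Poly_Mapping.keys_add by (fastforce simp: set_plus_def supported_def)
  show "supported (A \<union> B) \<subseteq> (supported A :: 'k poly2 set) + supported B"
  proof
    fix f :: "'k poly2" assume f: "f \<in> supported (A \<union> B)"
    have "f = restr A f + restr (B - A) f"
      using f by (intro poly_mapping_eqI) (auto simp: lookup_add lookup_restr supported_def in_keys_iff)
    moreover have "restr A f \<in> supported A" "restr (B - A) f \<in> supported B"
      by (auto simp: supported_def keys_restr)
    ultimately show "f \<in> supported A + supported B" by (metis set_plus_intro)
  qed
qed

lemma deg_add [simp]: "deg (u + v) = deg u + deg v"
  by (simp add: deg_def)

lemma deg_Pair [simp]: "deg (a, b) = a + b"
  by (simp add: deg_def)

definition var_x :: monom2 where "var_x = (1, 0)"
definition var_y :: monom2 where "var_y = (0, 1)"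

lemma var_simps [simp]:
  "fst var_x = 1" "snd var_x = 0" "deg var_x = 1" "fst var_y = 0" "snd var_y = 1" "deg var_y = 1"
  by (simp_all add: var_x_def var_y_def)

lemma in_monoms [simp]: "m \<in> monoms i \<longleftrightarrow> deg m = i"
  by (simp add: monoms_def)

lemma monoms_conv: "monoms i = (\<lambda>b. (i - b, b)) ` {..i}"
  by (auto simp: monoms_def deg_def image_iff)

lemma finite_monoms [simp]: "finite (monoms i)"
  by (simp add: monoms_conv)

lemma card_monoms: "card (monoms i) = Suc i"
  unfolding monoms_conv by (subst card_image) (auto simp: inj_on_def)

lemma monom_eqI: "deg m = deg m' \<Longrightarrow> snd m = snd m' \<Longrightarrow> m = m'"
  by (cases m; cases m') (simp add: deg_def)

lemma monom_split:
  assumes "0 < deg m"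
  obtains v m' where "v \<in> {var_x, var_y}" "m = v + m'" "deg m = Suc (deg m')"
proof (cases "fst m = 0")
  case True
  then show ?thesis
    using assms by (intro that[of "var_y" "(0, snd m - 1)"]) (auto simp: deg_def prod_eq_iff)
next
  case False
  then show ?thesis
    by (intro that[of "var_x" "(fst m - 1, snd m)"]) (auto simp: deg_def prod_eq_iff)
qed

lemma max_ideal_eq: "max_ideal = (supported {m. 1 \<le> deg m} :: 'k::field poly2 set)"
proof -
  have "max_ideal = ideal_gen (mon ` {var_x,var_y} :: 'k poly2 set)"
    by (simp add: max_ideal_def var_x_def var_y_def)
  moreover have "{w + g | w g. g \<in> {var_x,var_y}} = {m. 1 \<le> deg m}"
  proof (intro equalityI subsetI)
    fix m assume "m \<in> {m. 1 \<le> deg m}"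
    then have "0 < deg m" by simp
    then obtain v m' where "v \<in> {var_x, var_y}" "m = v + m'" "deg m = Suc (deg m')"
      by (rule monom_split)
    then show "m \<in> {w + g | w g. g \<in> {var_x,var_y}}"
      unfolding mem_Collect_eq by (intro exI[of _ m'] exI[of _ v]) (simp add: add.commute)
  qed auto
  ultimately show ?thesis by (simp only: ideal_gen_mon)
qed

lemma ideal_power_max_ideal:
  "ideal_power max_ideal n = (supported {m. n \<le> deg m} :: 'k::field poly2 set)"
proof (induction n)
  case 0
  show ?case by (simp add: supported_def)
next
  case (Suc n)
  let ?G = "{f * g | f g. f \<in> max_ideal \<and> g \<in> ideal_power max_ideal n} :: 'k poly2 set"
  let ?S = "{m. Suc n \<le> deg m}"
  have S: "ideal_gen (mon ` ?S) = (supported ?S :: 'k poly2 set)"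
    by (rule ideal_gen_mon_upward) simp
  have "?G \<subseteq> supported ?S"
  proof
    fix h assume "h \<in> ?G"
    then obtain f g where h: "h = f * g" and "f \<in> max_ideal" "g \<in> ideal_power max_ideal n"
      by auto
    then have f: "keys f \<subseteq> {m. 1 \<le> deg m}" and g: "keys g \<subseteq> {m. n \<le> deg m}"
      by (simp_all only: Suc.IH) (simp_all add: max_ideal_eq supported_def)
    show "h \<in> supported ?S"
      using keys_mult[of f g] f g unfolding h supported_def by fastforce
  qed
  then have "ideal_gen ?G \<subseteq> ideal_gen (supported ?S)" by (rule idl.span_mono)
  also have "\<dots> = supported ?S" by (metis S idl.span_span)
  finally have 1: "ideal_gen ?G \<subseteq> supported ?S" .
  have "mon ` ?S \<subseteq> ?G"
  proof
    fix f :: "'k poly2" assume "f \<in> mon ` ?S"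
    then obtain m where f: "f = mon m" and m: "Suc n \<le> deg m" by auto
    then have "0 < deg m" by simp
    then obtain v m' where v: "v \<in> {var_x, var_y}" "m = v + m'" "deg m = Suc (deg m')"
      by (rule monom_split)
    have "f = mon v * mon m'" by (simp add: f v(2) mon_def Poly_Mapping.mult_single)
    moreover have "mon v \<in> (max_ideal :: 'k poly2 set)"
      using v by (auto simp: max_ideal_eq supported_def)
    moreover have "mon m' \<in> (ideal_power max_ideal n :: 'k poly2 set)"
      using v m by (simp only: Suc.IH) (simp add: supported_def)
    ultimately show "f \<in> ?G" by blast
  qed
  then have "ideal_gen (mon ` ?S) \<subseteq> ideal_gen ?G" by (rule idl.span_mono)
  with 1 S show ?case by simp
qed

subsection \<open>Dimensions of spans of monomials\<close>

text \<open>The spans of monomials are described by supports as well, so that intersections with them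
  and dimensions can be read off from sets of monomials.\<close>
lemma lin_span_mon: "lin_span (mon ` S :: 'k::field poly2 set) = supported S"
proof
  have "lin.subspace (supported S :: 'k poly2 set)"
    unfolding lin.subspace_def supported_def
  proof (intro conjI ballI allI CollectI)
    fix f g :: "'k poly2" assume "f \<in> {f. keys f \<subseteq> S}" "g \<in> {f. keys f \<subseteq> S}"
    then show "keys (f + g) \<subseteq> S" using Poly_Mapping.keys_add[of f g] by blast
  next
    fix a :: 'k and f :: "'k poly2" assume "f \<in> {f. keys f \<subseteq> S}"
    then show "keys (scale a f) \<subseteq> S" using keys_scale[of a f] by blast
  qed simp
  moreover have "mon ` S \<subseteq> (supported S :: 'k poly2 set)" by (auto simp: supported_def)
  ultimately show "lin_span (mon ` S) \<subseteq> (supported S :: 'k poly2 set)"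
    by (intro lin.span_minimal)
  show "(supported S :: 'k poly2 set) \<subseteq> lin_span (mon ` S)"
  proof
    fix f :: "'k poly2" assume f: "f \<in> supported S"
    have "single u (lookup f u) \<in> lin_span (mon ` S)" if "u \<in> keys f" for u
    proof -
      have "single u (lookup f u) = scale (lookup f u) (mon u)"
        by (simp add: mon_def scale_def Poly_Mapping.mult_single)
      then show ?thesis using that f by (auto simp: supported_def intro: lin.span_scale lin.span_base)
    qed
    then have "(\<Sum>u\<in>keys f. single u (lookup f u)) \<in> lin_span (mon ` S)"
      by (intro lin.span_sum)
    then show "f \<in> lin_span (mon ` S)" by (simp add: sum_single_lookup)
  qed
qed

lemma inj_mon: "inj (mon :: monom2 \<Rightarrow> 'k::field poly2)"
  by (metis injI keys_mon singleton_inject)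

lemma independent_mon: "lin.independent (mon ` S :: 'k::field poly2 set)"
  unfolding lin.dependent_def
proof
  assume "\<exists>a\<in>mon ` S. a \<in> lin_span (mon ` S - {a} :: 'k poly2 set)"
  then obtain m where "(mon m :: 'k poly2) \<in> lin_span (mon ` S - {mon m})" by auto
  also have "mon ` S - {mon m} = (mon ` (S - {m}) :: 'k poly2 set)"
    using inj_mon by (auto dest: injD)
  finally show False by (simp add: lin_span_mon supported_def)
qed

lemma lin_dim_supported: "lin_dim (supported S :: 'k::field poly2 set) = card S"
proof -
  have "lin_dim (supported S :: 'k poly2 set) = card (mon ` S :: 'k poly2 set)"
    using lin.dim_span_eq_card_independent[OF independent_mon[of S]] by (simp only: lin_span_mon)
  also have "\<dots> = card S"
    using inj_mon by (intro card_image) (auto intro: inj_on_subset)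
  finally show ?thesis .
qed

section \<open>Normal form systems and the points of a Jordan cell\<close>

lemma C_mon_down:
  assumes "is_partition P" "u + w \<in> C_mon P"
  shows "w \<in> C_mon P"
proof -
  obtain a b where w: "w = (a, b)" by (cases w)
  obtain a' b' where u: "u = (a', b')" by (cases u)
  from assms(2) have b: "b' + b < length P" and a: "a' + a < P ! (b' + b)"
    by (auto simp: C_mon_def u w)
  have "P ! (b' + b) \<le> P ! b"
  proof (cases "b' = 0")
    case False
    then show ?thesis
      using assms(1) b sorted_wrt_nth_less[of "(\<ge>)" P b "b' + b"] by (auto simp: is_partition_def)
  qed simp
  with a b show ?thesis by (auto simp: C_mon_def w)
qed

lemma in_E_mon [simp]: "m \<in> E_mon P \<longleftrightarrow> m \<notin> C_mon P"
  by (simp add: E_mon_def)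

lemma E_mon_up: "is_partition P \<Longrightarrow> m \<in> E_mon P \<Longrightarrow> w + m \<in> E_mon P"
  using C_mon_down[of P w m] by auto

lemma fst_lt_sum_list:
  assumes "c \<in> C_mon P"
  shows "fst c < sum_list P"
proof -
  have "snd c < length P" "fst c < P ! snd c" using assms by (auto simp: C_mon_def)
  moreover from this have "P ! snd c \<le> sum_list P" by (intro member_le_sum_list) auto
  ultimately show ?thesis by simp
qed

lemma finite_C_mon [simp]: "finite (C_mon P)"
proof (rule finite_subset)
  show "C_mon P \<subseteq> {..<sum_list P} \<times> {..<length P}"
    using fst_lt_sum_list[of _ P] by (force simp: C_mon_def)
qed simp

lemma E_ideal_eq: "is_partition P \<Longrightarrow> E_ideal P = (supported (E_mon P) :: 'k::field poly2 set)"
  unfolding E_ideal_def by (intro ideal_gen_mon_upward E_mon_up)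

text \<open>The index pairs of the coordinates of the cell: \<open>c\<close> may occur as a lower term of the reduced
  form with initial monomial \<open>m\<close>.\<close>
definition tails :: "nat list \<Rightarrow> (monom2 \<times> monom2) set" where
  "tails P = {(m, c). m \<in> E_mon P \<and> c \<in> C_mon P \<and> deg c = deg m \<and> snd c < snd m}"

lemma in_tails: "(m, c) \<in> tails P \<longleftrightarrow> m \<in> E_mon P \<and> c \<in> C_mon P \<and> deg c = deg m \<and> snd c < snd m"
  by (simp add: tails_def)

text \<open>\<open>N m c\<close> is thought of as the coefficient of \<open>c\<close> in the normal form of \<open>m\<close>. The shape expresses
  that monomials of the diagram are their own normal forms and that the others reduce to earlier
  monomials; a step at \<open>v\<close> says that \<open>v m\<close> may be reduced by first reducing \<open>m\<close>.\<close>
definition nf_shape :: "nat list \<Rightarrow> (monom2 \<Rightarrow> monom2 \<Rightarrow> 'r::comm_ring_1) \<Rightarrow> bool" where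
  "nf_shape P N \<longleftrightarrow> (\<forall>m\<in>C_mon P. \<forall>c. N m c = of_bool (m = c)) \<and>
     (\<forall>m\<in>E_mon P. \<forall>c. (m, c) \<notin> tails P \<longrightarrow> N m c = 0)"

definition nf_step :: "nat list \<Rightarrow> (monom2 \<Rightarrow> monom2 \<Rightarrow> 'r::comm_ring_1) \<Rightarrow> monom2 \<Rightarrow> monom2 \<Rightarrow> monom2 \<Rightarrow> bool" where
  "nf_step P N v m c \<longleftrightarrow> N (v + m) c = (\<Sum>u\<in>C_mon P. N m u * N (v + u) c)"

definition is_nf :: "nat list \<Rightarrow> (monom2 \<Rightarrow> monom2 \<Rightarrow> 'r::comm_ring_1) \<Rightarrow> bool" where
  "is_nf P N \<longleftrightarrow> nf_shape P N \<and>
     (\<forall>v\<in>{var_x, var_y}. \<forall>m\<in>E_mon P. \<forall>c\<in>C_mon P. nf_step P N v m c)"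

lemma nf_shape_C: "nf_shape P N \<Longrightarrow> m \<in> C_mon P \<Longrightarrow> N m c = of_bool (m = c)"
  unfolding nf_shape_def by blast

lemma nf_shape_E: "nf_shape P N \<Longrightarrow> m \<in> E_mon P \<Longrightarrow> (m, c) \<notin> tails P \<Longrightarrow> N m c = 0"
  unfolding nf_shape_def by blast

lemma nf_shape_outside: "nf_shape P N \<Longrightarrow> c \<in> E_mon P \<Longrightarrow> N m c = 0"
  by (cases "m \<in> C_mon P") (auto simp: nf_shape_C nf_shape_E in_tails E_mon_def)

lemma nf_shape_deg: "nf_shape P N \<Longrightarrow> deg m \<noteq> deg c \<Longrightarrow> N m c = 0"
  by (cases "m \<in> C_mon P") (auto simp: nf_shape_C nf_shape_E in_tails)

lemma nf_shape_snd: "nf_shape P N \<Longrightarrow> snd m < snd c \<Longrightarrow> N m c = 0"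
  by (cases "m \<in> C_mon P") (auto simp: nf_shape_C nf_shape_E in_tails)

lemma nf_step_C:
  assumes "nf_shape P N" "m \<in> C_mon P"
  shows "nf_step P N v m c"
proof -
  have "(\<Sum>u\<in>C_mon P. N m u * N (v + u) c) = (\<Sum>u\<in>C_mon P. if u = m then N (v + m) c else 0)"
    using assms by (intro sum.cong) (auto simp: nf_shape_C)
  then show ?thesis using assms(2) by (simp add: nf_step_def)
qed

text \<open>For \<open>m\<close> in the diagram a step is trivial since \<open>m\<close> is its own normal form, and for \<open>c\<close> outside
  the diagram both sides vanish.\<close>
lemma nf_step_everywhere:
  assumes "nf_shape P N" "\<And>m c. m \<in> E_mon P \<Longrightarrow> c \<in> C_mon P \<Longrightarrow> nf_step P N v m c"
  shows "nf_step P N v m c"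
proof (cases "m \<in> C_mon P")
  case True
  then show ?thesis using assms(1) by (simp add: nf_step_C)
next
  case False
  show ?thesis
  proof (cases "c \<in> C_mon P")
    case False
    then show ?thesis by (simp add: nf_step_def nf_shape_outside[OF assms(1)])
  qed (use False assms(2) in auto)
qed

lemma is_nf_step:
  assumes "is_nf P N" "v \<in> {var_x, var_y}"
  shows "nf_step P N v m c"
  by (rule nf_step_everywhere) (use assms in \<open>unfold is_nf_def, blast+\<close>)

text \<open>Compatibility with the two variables gives compatibility with all monomials, one variable at
  a time.\<close>
lemma is_nf_mult:
  assumes "is_nf P N"
  shows "N (w + m) c = (\<Sum>u\<in>C_mon P. N m u * N (w + u) c)"
proof (induction "deg w" arbitrary: w c)
  case 0
  then have w: "w = 0" by (simp add: deg_def prod_eq_iff)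
  have s: "nf_shape P N" using assms by (simp add: is_nf_def)
  show ?case
  proof (cases "c \<in> C_mon P")
    case True
    have "(\<Sum>u\<in>C_mon P. N m u * N (w + u) c) = (\<Sum>u\<in>C_mon P. if u = c then N m c else 0)"
      using s by (intro sum.cong) (auto simp: w nf_shape_C)
    then show ?thesis using True by (simp add: w)
  next
    case False
    then show ?thesis by (simp add: nf_shape_outside[OF s])
  qed
next
  case (Suc n)
  then have "0 < deg w" by simp
  then obtain v w' where v: "v \<in> {var_x, var_y}" "w = v + w'" "deg w = Suc (deg w')"
    by (rule monom_split)
  have step: "N (v + m) c = (\<Sum>u\<in>C_mon P. N m u * N (v + u) c)" for m c
    by (rule is_nf_step[OF assms v(1), unfolded nf_step_def])
  have IH: "N (w' + m) c = (\<Sum>u\<in>C_mon P. N m u * N (w' + u) c)" for c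
    using Suc.hyps v(3) by simp
  have "N (w + m) c = (\<Sum>t\<in>C_mon P. N (w' + m) t * N (v + t) c)"
    using step[of "w' + m" c] by (simp add: v add.assoc)
  also have "\<dots> = (\<Sum>t\<in>C_mon P. \<Sum>u\<in>C_mon P. N m u * (N (w' + u) t * N (v + t) c))"
    by (subst IH) (simp add: sum_distrib_right mult.assoc)
  also have "\<dots> = (\<Sum>u\<in>C_mon P. N m u * (\<Sum>t\<in>C_mon P. N (w' + u) t * N (v + t) c))"
    by (subst sum.swap) (simp add: sum_distrib_left)
  also have "\<dots> = (\<Sum>u\<in>C_mon P. N m u * N (w + u) c)"
    by (simp add: v add.assoc flip: step)
  finally show ?case .
qed

definition nf_of :: "(monom2 \<Rightarrow> monom2 \<Rightarrow> 'k::field) \<Rightarrow> 'k poly2 \<Rightarrow> monom2 \<Rightarrow> 'k" where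
  "nf_of N f c = linear_ext (\<lambda>a. a) (\<lambda>m. N m c) f"

definition nf_ideal :: "(monom2 \<Rightarrow> monom2 \<Rightarrow> 'k::field) \<Rightarrow> 'k poly2 set" where
  "nf_ideal N = {f. \<forall>c. nf_of N f c = 0}"

lemma nf_of_superset:
  "finite S \<Longrightarrow> keys f \<subseteq> S \<Longrightarrow> nf_of N f c = (\<Sum>m\<in>S. lookup f m * N m c)"
  unfolding nf_of_def by (rule linear_ext_superset[OF ring_map_id])

lemma nf_of_keys: "nf_of N f c = (\<Sum>m\<in>keys f. lookup f m * N m c)"
  by (rule nf_of_superset) auto

text \<open>The normal form of \<open>w f\<close> is obtained by reducing \<open>w\<close> times the normal form of \<open>f\<close>, so it
  vanishes together with the latter.\<close>
lemma is_ideal_nf_ideal: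
  assumes "is_nf P N"
  shows "is_ideal (nf_ideal N)"
proof -
  have add: "f + g \<in> nf_ideal N" if "f \<in> nf_ideal N" "g \<in> nf_ideal N" for f g
    using that by (simp add: nf_ideal_def nf_of_def linear_ext_add[OF ring_map_id])
  have zero: "0 \<in> nf_ideal N" by (simp add: nf_ideal_def nf_of_def linear_ext_0)
  have single: "single w a * f \<in> nf_ideal N" if f: "f \<in> nf_ideal N" for w a f
    unfolding nf_ideal_def
  proof (intro CollectI allI)
    fix c
    have "nf_of N (single w a * f) c = a * linear_ext (\<lambda>a. a) (\<lambda>m. N (w + m) c) f"
      unfolding nf_of_def by (rule linear_ext_single_mult[OF ring_map_id])
    also have "linear_ext (\<lambda>a. a) (\<lambda>m. N (w + m) c) f
        = (\<Sum>m\<in>keys f. \<Sum>u\<in>C_mon P. lookup f m * (N m u * N (w + u) c))"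
      unfolding linear_ext_def by (subst is_nf_mult[OF assms]) (simp add: sum_distrib_left)
    also have "\<dots> = (\<Sum>u\<in>C_mon P. nf_of N f u * N (w + u) c)"
      by (subst sum.swap) (simp add: nf_of_keys sum_distrib_right mult.assoc)
    also have "\<dots> = 0" using f by (simp add: nf_ideal_def)
    finally show "nf_of N (single w a * f) c = 0" by simp
  qed
  have "p * f \<in> nf_ideal N" if f: "f \<in> nf_ideal N" for p f
  proof -
    have "(\<Sum>u\<in>S. single u (lookup p u) * f) \<in> nf_ideal N" for S
      by (induction S rule: infinite_finite_induct) (auto intro: zero add single f)
    from this[of "keys p"] show ?thesis by (simp add: sum_single_lookup flip: sum_distrib_right)
  qed
  with add zero show ?thesis by (auto simp: is_ideal_iff)
qed

lemma graded_nf_ideal: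
  assumes "is_nf P N"
  shows "graded_ideal (nf_ideal N)"
  unfolding graded_ideal_def
proof (intro conjI ballI allI)
  show "is_ideal (nf_ideal N)" using assms by (rule is_ideal_nf_ideal)
  fix f i assume f: "f \<in> nf_ideal N"
  have s: "nf_shape P N" using assms by (simp add: is_nf_def)
  have "nf_of N (restr (monoms i) f) c = 0" for c
  proof -
    have "nf_of N (restr (monoms i) f) c = (\<Sum>m\<in>keys f. lookup (restr (monoms i) f) m * N m c)"
      by (intro nf_of_superset) (auto simp: keys_restr)
    also have "\<dots> = (\<Sum>m\<in>keys f. if deg c = i then lookup f m * N m c else 0)"
      by (intro sum.cong) (auto simp: lookup_restr nf_shape_deg[OF s])
    also have "\<dots> = (if deg c = i then nf_of N f c else 0)"
      by (simp add: nf_of_keys)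
    also have "\<dots> = 0" using f by (simp add: nf_ideal_def)
    finally show ?thesis .
  qed
  then show "restr (monoms i) f \<in> nf_ideal N" by (simp add: nf_ideal_def)
qed

subsection \<open>Initial monomials\<close>

lemma forms_deg: "f \<in> forms i \<Longrightarrow> u \<in> keys f \<Longrightarrow> deg u = i"
  by (auto simp: forms_def)

lemma keys_nonempty: "f \<noteq> 0 \<Longrightarrow> \<exists>k. k \<in> keys f"
  by (simp add: poly_mapping_eq_iff fun_eq_iff in_keys_iff)

lemma initial_monomial:
  assumes "f \<noteq> 0"
  shows "initial_monomial f \<in> keys f" "\<And>m. m \<in> keys f \<Longrightarrow> snd m \<le> snd (initial_monomial f)"
proof -
  obtain k where "k \<in> keys f" using keys_nonempty[OF assms] by blast
  moreover have "\<forall>y. y \<in> keys f \<longrightarrow> snd y < Suc (Max (snd ` keys f))"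
    by (simp add: le_imp_less_Suc)
  ultimately have "initial_monomial f \<in> keys f \<and> (\<forall>y. y \<in> keys f \<longrightarrow> snd y \<le> snd (initial_monomial f))"
    unfolding initial_monomial_def arg_max_on_def by (rule arg_max_nat_lemma)
  then show "initial_monomial f \<in> keys f" "\<And>m. m \<in> keys f \<Longrightarrow> snd m \<le> snd (initial_monomial f)"
    by auto
qed

lemma initial_monomial_eqI:
  assumes "m \<in> keys f" "f \<in> forms i" "\<And>u. u \<in> keys f \<Longrightarrow> snd u \<le> snd m"
  shows "initial_monomial f = m"
proof -
  have "f \<noteq> 0" using assms(1) by auto
  note im = initial_monomial[OF this]
  have "deg (initial_monomial f) = deg m"
    using forms_deg[OF assms(2)] assms(1) im(1) by simp
  moreover have "snd (initial_monomial f) = snd m"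
    using im(2)[OF assms(1)] assms(3)[OF im(1)] by simp
  ultimately show ?thesis by (rule monom_eqI)
qed

definition initial_monoms :: "'k::field poly2 set \<Rightarrow> monom2 set" where
  "initial_monoms I = {initial_monomial f | f. f \<in> I \<and> f \<noteq> 0 \<and> (\<exists>i. f \<in> forms i)}"

text \<open>The initial monomials of the forms in an ideal are closed under multiplication by monomials.
  Hence membership in a Jordan cell becomes an equation between two sets of monomials.\<close>
lemma initial_ideal_eq:
  fixes I :: "'k::field poly2 set"
  assumes "is_ideal I"
  shows "initial_ideal I = supported (initial_monoms I)"
proof -
  have "initial_ideal I = ideal_gen (mon ` initial_monoms I)"
    unfolding initial_ideal_def initial_monoms_def by (rule arg_cong[where f = ideal_gen]) auto
  moreover have "w + m \<in> initial_monoms I" if "m \<in> initial_monoms I" for w m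
  proof -
    from that obtain f i where f: "m = initial_monomial f" "f \<in> I" "f \<noteq> 0" "f \<in> forms i"
      by (auto simp: initial_monoms_def)
    let ?g = "single w 1 * f"
    have k: "keys ?g \<subseteq> (+) w ` keys f" by (rule keys_single_mult)
    have m: "m \<in> keys f" "\<And>u. u \<in> keys f \<Longrightarrow> snd u \<le> snd m"
      using initial_monomial[OF f(3)] by (auto simp: f(1))
    have "w + m \<in> keys ?g" using m(1) by (simp add: in_keys_iff lookup_single_mult_add)
    moreover have g: "?g \<in> forms (deg w + i)" using k f(4) by (fastforce simp: forms_def)
    moreover have "snd u \<le> snd (w + m)" if "u \<in> keys ?g" for u
      using that k m(2) by fastforce
    ultimately have "initial_monomial ?g = w + m" by (rule initial_monomial_eqI)
    moreover have "?g \<noteq> 0" using \<open>w + m \<in> keys ?g\<close> by auto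
    moreover have "?g \<in> I" using f(2) assms by (simp add: is_ideal_iff)
    ultimately show ?thesis using g unfolding initial_monoms_def
      by (intro CollectI exI[of _ ?g]) auto
  qed
  ultimately show ?thesis by (simp add: ideal_gen_mon_upward)
qed

lemma jordan_cell_iff:
  assumes "is_partition P"
  shows "I \<in> jordan_cell P \<longleftrightarrow> graded_ideal I \<and> initial_monoms I = E_mon P"
proof (cases "graded_ideal I")
  case True
  then have "initial_ideal I = supported (initial_monoms I)"
    by (simp add: graded_ideal_def initial_ideal_eq)
  then show ?thesis
    using True by (auto simp: jordan_cell_def E_ideal_eq[OF assms] dest: supported_inject)
qed (simp add: jordan_cell_def)

text \<open>The difference of a monomial and its normal form, which is the reduced form with initial
  monomial \<open>m\<close>.\<close>
definition nf_poly :: "nat list \<Rightarrow> (monom2 \<Rightarrow> monom2 \<Rightarrow> 'k::field) \<Rightarrow> monom2 \<Rightarrow> 'k poly2" where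
  "nf_poly P N m = mon m - (\<Sum>c\<in>C_mon P. single c (N m c))"

lemma lookup_nf_poly:
  assumes "nf_shape P N" "m \<in> E_mon P"
  shows "lookup (nf_poly P N m) u = (if u = m then 1 else - N m u)"
proof -
  have "(\<Sum>c\<in>C_mon P. lookup (single c (N m c)) u) = (\<Sum>c\<in>C_mon P. if c = u then N m u else 0)"
    by (intro sum.cong) (auto simp: lookup_single when_def)
  also have "\<dots> = N m u" using nf_shape_outside[OF assms(1), of u m] by (auto simp: E_mon_def)
  finally have "lookup (nf_poly P N m) u = of_bool (m = u) - N m u"
    by (simp add: nf_poly_def lookup_minus lookup_sum lookup_mon)
  moreover have "N m m = 0" using nf_shape_outside[OF assms] by simp
  ultimately show ?thesis by auto
qed

lemma keys_nf_poly:
  assumes "nf_shape P N" "m \<in> E_mon P"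
  shows "keys (nf_poly P N m) \<subseteq> insert m {c. (m, c) \<in> tails P}"
proof
  fix u assume "u \<in> keys (nf_poly P N m)"
  then have "u = m \<or> N m u \<noteq> 0"
    by (auto simp: in_keys_iff lookup_nf_poly[OF assms] split: if_splits)
  then show "u \<in> insert m {c. (m, c) \<in> tails P}"
    using nf_shape_E[OF assms, of u] by blast
qed

lemma nf_poly_in_ideal:
  assumes "nf_shape P N" "m \<in> E_mon P"
  shows "nf_poly P N m \<in> nf_ideal N"
  unfolding nf_ideal_def
proof (intro CollectI allI)
  fix c
  let ?f = "nf_poly P N m"
  have m: "m \<notin> C_mon P" using assms(2) by (simp add: E_mon_def)
  have "keys ?f \<subseteq> insert m (C_mon P)"
    using keys_nf_poly[OF assms] by (auto simp: in_tails)
  then have "nf_of N ?f c = (\<Sum>u\<in>insert m (C_mon P). lookup ?f u * N u c)"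
    by (intro nf_of_superset) auto
  also have "\<dots> = N m c + (\<Sum>u\<in>C_mon P. lookup ?f u * N u c)"
    using m by (simp add: lookup_nf_poly[OF assms])
  also have "(\<Sum>u\<in>C_mon P. lookup ?f u * N u c) = (\<Sum>u\<in>C_mon P. if u = c then - N m c else 0)"
    using m by (intro sum.cong) (auto simp: lookup_nf_poly[OF assms] nf_shape_C[OF assms(1)])
  also have "N m c + \<dots> = 0"
    using nf_shape_outside[OF assms(1), of c m] by (auto simp: E_mon_def)
  finally show "nf_of N ?f c = 0" .
qed

text \<open>In the normal form of a form with initial monomial \<open>m \<in> C\<close> the term \<open>m\<close> cannot cancel, because
  the other terms reduce to monomials before \<open>m\<close>; so a form with normal form \<open>0\<close> has its initial
  monomial in \<open>E\<close>. All of \<open>E\<close> is reached by the reduced forms.\<close>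
lemma nf_ideal_in_cell:
  assumes "is_partition P" "is_nf P N"
  shows "nf_ideal N \<in> jordan_cell P"
proof -
  have s: "nf_shape P N" using assms by (simp add: is_nf_def)
  have "initial_monoms (nf_ideal N) = E_mon P"
  proof (intro equalityI subsetI)
    fix m assume "m \<in> initial_monoms (nf_ideal N)"
    then obtain f i where f: "m = initial_monomial f" "f \<in> nf_ideal N" "f \<noteq> 0" "f \<in> forms i"
      by (auto simp: initial_monoms_def)
    show "m \<in> E_mon P"
    proof (rule ccontr)
      assume "m \<notin> E_mon P"
      then have C: "m \<in> C_mon P" by simp
      note im = initial_monomial[OF f(3), folded f(1)]
      have "N u m = (if u = m then 1 else 0)" if u: "u \<in> keys f" for u
      proof (cases "u = m")
        case True
        then show ?thesis using C nf_shape_C[OF s] by auto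
      next
        case False
        have "deg u = deg m" using forms_deg[OF f(4)] u im(1) by simp
        with im(2)[OF u] False have "(u, m) \<notin> tails P" "snd u < snd m"
          using monom_eqI[of u m] by (auto simp: in_tails le_less)
        then show ?thesis using nf_shape_snd[OF s] False by simp
      qed
      then have "nf_of N f m = (\<Sum>u\<in>keys f. if u = m then lookup f m else 0)"
        unfolding nf_of_keys by (intro sum.cong) auto
      then have "nf_of N f m = lookup f m" using im(1) by simp
      then show False using f(2) im(1) by (simp add: nf_ideal_def in_keys_iff)
    qed
  next
    fix m assume m: "m \<in> E_mon P"
    let ?f = "nf_poly P N m"
    have k: "keys ?f \<subseteq> insert m {c. (m, c) \<in> tails P}" using s m by (rule keys_nf_poly)
    have mk: "m \<in> keys ?f" by (simp add: in_keys_iff lookup_nf_poly[OF s m])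
    have fm: "?f \<in> forms (deg m)" using k by (auto simp: forms_def in_tails)
    have "initial_monomial ?f = m"
      using mk fm by (rule initial_monomial_eqI) (use k in \<open>auto simp: in_tails\<close>)
    moreover have "?f \<noteq> 0" using mk by auto
    ultimately show "m \<in> initial_monoms (nf_ideal N)"
      using nf_poly_in_ideal[OF s m] fm unfolding initial_monoms_def
      by (intro CollectI exI[of _ ?f]) auto
  qed
  then show ?thesis using graded_nf_ideal[OF assms(2)] by (simp add: jordan_cell_iff[OF assms(1)])
qed

subsection \<open>Coordinates\<close>

text \<open>A nonzero homogeneous component would have its initial monomial both in \<open>C\<close> and in \<open>E\<close>.\<close>
lemma cell_zero:
  assumes "is_partition P" "I \<in> jordan_cell P" "f \<in> I" "keys f \<subseteq> C_mon P"
  shows "f = 0"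
proof (rule ccontr)
  assume "f \<noteq> 0"
  then obtain m where m: "m \<in> keys f" using keys_nonempty by blast
  let ?g = "restr (monoms (deg m)) f"
  have k: "keys ?g = keys f \<inter> monoms (deg m)" by (rule keys_restr)
  then have g: "?g \<noteq> 0" using m by auto
  have I: "graded_ideal I" "initial_monoms I = E_mon P" using assms by (simp_all add: jordan_cell_iff)
  have "?g \<in> I" using I(1) assms(3) by (simp add: graded_ideal_def)
  moreover have "?g \<in> forms (deg m)" using k by (simp add: forms_def)
  ultimately have "initial_monomial ?g \<in> E_mon P" using g I(2) unfolding initial_monoms_def by blast
  moreover have "initial_monomial ?g \<in> C_mon P" using initial_monomial(1)[OF g] k assms(4) by auto
  ultimately show False by (simp add: E_mon_def)
qed

text \<open>Gaussian elimination: a form with initial monomial \<open>m\<close> is normalized and freed of its other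
  terms in \<open>E\<close> by subtracting multiples of the reduced forms that belong to smaller \<open>y\<close>-degrees.\<close>
lemma cell_reduced_exists:
  fixes I :: "'k::field poly2 set"
  assumes "is_partition P" "I \<in> jordan_cell P" "m \<in> E_mon P"
  shows "\<exists>f\<in>I. lookup f m = 1 \<and> keys f \<subseteq> insert m {c. (m, c) \<in> tails P}"
  using assms(3)
proof (induction "snd m" arbitrary: m rule: less_induct)
  case less
  have I: "graded_ideal I" "initial_monoms I = E_mon P" using assms by (simp_all add: jordan_cell_iff)
  then have id: "is_ideal I" by (simp add: graded_ideal_def)
  from I(2) less.prems obtain g i where g: "m = initial_monomial g" "g \<in> I" "g \<noteq> 0" "g \<in> forms i"
    unfolding initial_monoms_def by blast
  note im = initial_monomial[OF g(3), folded g(1)]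
  define h where "h = scale (1 / lookup g m) g"
  have hI: "h \<in> I" unfolding h_def by (rule is_ideal_scale[OF id g(2)])
  have gm: "lookup g m \<noteq> 0" using im(1) by (simp add: in_keys_iff)
  have hm: "lookup h m = 1" using gm by (simp add: h_def)
  have hk: "deg u = deg m \<and> snd u \<le> snd m" if "u \<in> keys h" for u
  proof -
    have "u \<in> keys g" using that keys_scale unfolding h_def by blast
    then show ?thesis using im forms_deg[OF g(4)] by simp
  qed
  define K where "K = keys h \<inter> E_mon P - {m}"
  have fK: "finite K" by (simp add: K_def)
  have "\<forall>e\<in>K. \<exists>f\<in>I. lookup f e = 1 \<and> keys f \<subseteq> insert e {c. (e, c) \<in> tails P}"
  proof
    fix e assume e: "e \<in> K"
    then have "deg e = deg m" "snd e \<le> snd m" "e \<noteq> m" using hk by (auto simp: K_def)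
    then have "snd e < snd m" using monom_eqI[of e m] by force
    then show "\<exists>f\<in>I. lookup f e = 1 \<and> keys f \<subseteq> insert e {c. (e, c) \<in> tails P}"
      using less.hyps e by (simp add: K_def)
  qed
  then obtain F where F: "\<And>e. e \<in> K \<Longrightarrow> F e \<in> I" "\<And>e. e \<in> K \<Longrightarrow> lookup (F e) e = 1"
    "\<And>e. e \<in> K \<Longrightarrow> keys (F e) \<subseteq> insert e {c. (e, c) \<in> tails P}"
    by metis
  define f where "f = h - (\<Sum>e\<in>K. scale (lookup h e) (F e))"
  have lf: "lookup f u = lookup h u - (\<Sum>e\<in>K. lookup h e * lookup (F e) u)" for u
    by (simp add: f_def lookup_minus lookup_sum)
  have FE: "lookup (F e) u = of_bool (e = u)" if "e \<in> K" "u \<in> E_mon P" for e u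
  proof (cases "e = u")
    case False
    then have "u \<notin> keys (F e)" using F(3)[OF that(1)] that(2) by (auto simp: in_tails E_mon_def)
    then show ?thesis using False by (simp add: in_keys_iff)
  qed (use F(2) that in auto)
  have lfE: "lookup f u = (if u = m then 1 else 0)" if u: "u \<in> E_mon P" for u
  proof -
    have "(\<Sum>e\<in>K. lookup h e * lookup (F e) u) = (\<Sum>e\<in>K. if e = u then lookup h u else 0)"
      using FE u by (intro sum.cong) auto
    also have "\<dots> = (if u \<in> K then lookup h u else 0)" using fK by simp
    finally show ?thesis using u hm by (auto simp: lf K_def in_keys_iff)
  qed
  have "f \<in> I" unfolding f_def
    by (intro is_ideal_diff is_ideal_sum is_ideal_scale id hI F(1))
  moreover have "lookup f m = 1" using lfE less.prems by simp
  moreover have "keys f \<subseteq> insert m {c. (m, c) \<in> tails P}"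
  proof
    fix u assume u: "u \<in> keys f"
    show "u \<in> insert m {c. (m, c) \<in> tails P}"
    proof (cases "u \<in> E_mon P")
      case True
      then show ?thesis using u lfE[OF True] by (simp add: in_keys_iff split: if_splits)
    next
      case False
      have "deg u = deg m \<and> snd u \<le> snd m"
      proof (cases "u \<in> keys h")
        case False
        have "\<exists>e\<in>K. u \<in> keys (F e)"
        proof (rule ccontr)
          assume "\<not> ?thesis"
          then have "lookup f u = 0" using False by (simp add: lf in_keys_iff)
          then show False using u by (simp add: in_keys_iff)
        qed
        then obtain e where e: "e \<in> K" "u \<in> keys (F e)" by blast
        then have "u = e \<or> (e, u) \<in> tails P" using F(3) by blast
        moreover have "deg e = deg m" "snd e \<le> snd m" using hk e(1) by (auto simp: K_def)
        ultimately show ?thesis by (auto simp: in_tails)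
      qed (rule hk)
      moreover from this have "snd u \<noteq> snd m" using False less.prems monom_eqI[of u m] by auto
      ultimately show ?thesis using False less.prems by (simp add: in_tails)
    qed
  qed
  ultimately show ?case by blast
qed

lemma reduced_form:
  assumes "is_partition P" "I \<in> jordan_cell P" "m \<in> E_mon P"
  shows "reduced_form P I m \<in> I" "lookup (reduced_form P I m) m = 1"
    "keys (reduced_form P I m) \<subseteq> insert m {c. (m, c) \<in> tails P}"
    "\<And>f. f \<in> I \<Longrightarrow> lookup f m = 1 \<Longrightarrow> keys f \<subseteq> insert m (C_mon P) \<Longrightarrow> reduced_form P I m = f"
proof -
  have uniq: "f = g" if "f \<in> I" "lookup f m = 1" "keys f \<subseteq> insert m (C_mon P)"
    "g \<in> I" "lookup g m = 1" "keys g \<subseteq> insert m (C_mon P)" for f g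
  proof -
    have "is_ideal I" using assms by (simp add: jordan_cell_iff graded_ideal_def)
    then have "f - g \<in> I" using that by (intro is_ideal_diff)
    moreover have "keys (f - g) \<subseteq> C_mon P"
    proof
      fix u assume u: "u \<in> keys (f - g)"
      then have "u \<noteq> m" using that by (auto simp: in_keys_iff lookup_minus)
      moreover have "u \<in> keys f \<or> u \<in> keys g" using u by (auto simp: in_keys_iff lookup_minus)
      ultimately show "u \<in> C_mon P" using that by blast
    qed
    ultimately have "f - g = 0" by (rule cell_zero[OF assms(1,2)])
    then show ?thesis by simp
  qed
  obtain f where f: "f \<in> I" "lookup f m = 1" "keys f \<subseteq> insert m {c. (m, c) \<in> tails P}"
    using cell_reduced_exists[OF assms] by blast
  have f': "keys f \<subseteq> insert m (C_mon P \<inter> monoms (deg m))" using f(3) by (auto simp: in_tails)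
  have eq: "reduced_form P I m = f"
    unfolding reduced_form_def
  proof (rule the_equality)
    fix g assume "g \<in> I \<and> lookup g m = 1 \<and> keys g \<subseteq> insert m (C_mon P \<inter> monoms (deg m))"
    then show "g = f" using f f' by (intro uniq) auto
  qed (use f f' in auto)
  show "reduced_form P I m \<in> I" "lookup (reduced_form P I m) m = 1"
    "keys (reduced_form P I m) \<subseteq> insert m {c. (m, c) \<in> tails P}"
    using f by (simp_all add: eq)
  show "reduced_form P I m = g" if "g \<in> I" "lookup g m = 1" "keys g \<subseteq> insert m (C_mon P)" for g
    using that f f' unfolding eq by (intro uniq) auto
qed

definition cell_nf :: "nat list \<Rightarrow> 'k::field poly2 set \<Rightarrow> monom2 \<Rightarrow> monom2 \<Rightarrow> 'k" where
  "cell_nf P I m c = (if m \<in> C_mon P then of_bool (m = c) else - cell_coord P I (m, c))"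

lemma cell_coord_eq:
  "cell_coord P I (m, c) = (if (m, c) \<in> tails P then lookup (reduced_form P I m) c else 0)"
  by (simp add: cell_coord_def in_tails)

lemma nf_shape_cell_nf: "nf_shape P (cell_nf P I)"
  by (auto simp: nf_shape_def cell_nf_def cell_coord_eq E_mon_def)

lemma reduced_form_eq_nf_poly:
  assumes "is_partition P" "I \<in> jordan_cell P" "m \<in> E_mon P"
  shows "reduced_form P I m = nf_poly P (cell_nf P I) m"
proof (rule poly_mapping_eqI)
  fix u
  show "lookup (reduced_form P I m) u = lookup (nf_poly P (cell_nf P I) m) u"
    using reduced_form(2,3)[OF assms] assms(3)
    by (auto simp: lookup_nf_poly[OF nf_shape_cell_nf assms(3)] cell_nf_def cell_coord_eq in_keys_iff E_mon_def)
qed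

text \<open>Subtract from \<open>f\<close> the reduced forms that belong to its terms in \<open>E\<close>. What remains is supported
  on \<open>C\<close>, its coefficients are those of the normal form of \<open>f\<close>, and it differs from \<open>f\<close> by an element
  of \<open>I\<close>. So \<open>f \<in> I\<close> if and only if it is zero.\<close>
lemma cell_eq_nf_ideal:
  fixes I :: "'k::field poly2 set"
  assumes "is_partition P" "I \<in> jordan_cell P"
  shows "nf_ideal (cell_nf P I) = I"
proof -
  let ?N = "cell_nf P I"
  have s: "nf_shape P ?N" by (rule nf_shape_cell_nf)
  have id: "is_ideal I" using assms by (simp add: jordan_cell_iff graded_ideal_def)
  have "f \<in> nf_ideal ?N \<longleftrightarrow> f \<in> I" for f
  proof -
    define K where "K = keys f \<inter> E_mon P"
    have fK: "finite K" by (simp add: K_def)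
    define r where "r = (\<Sum>e\<in>K. scale (lookup f e) (reduced_form P I e))"
    have rI: "r \<in> I" unfolding r_def K_def
      by (intro is_ideal_sum is_ideal_scale id reduced_form(1) assms) auto
    have l: "lookup (f - r) c = nf_of ?N f c" for c
    proof -
      have 1: "lookup r c = (\<Sum>e\<in>K. lookup f e * (if c = e then 1 else - ?N e c))"
        unfolding r_def lookup_sum
        by (intro sum.cong) (auto simp: K_def reduced_form_eq_nf_poly[OF assms] lookup_nf_poly[OF s])
      have "nf_of ?N f c = (\<Sum>m\<in>keys f. lookup f m * ?N m c)" by (rule nf_of_keys)
      also have "\<dots> = (\<Sum>m\<in>K. lookup f m * ?N m c) + (\<Sum>m\<in>keys f \<inter> C_mon P. lookup f m * ?N m c)"
        unfolding K_def by (subst sum.union_disjoint[symmetric]) (auto simp: E_mon_def intro!: sum.cong)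
      also have "(\<Sum>m\<in>keys f \<inter> C_mon P. lookup f m * ?N m c)
          = (\<Sum>m\<in>keys f \<inter> C_mon P. if m = c then lookup f c else 0)"
        by (intro sum.cong) (auto simp: nf_shape_C[OF s])
      also have "\<dots> = (if c \<in> C_mon P then lookup f c else 0)"
        by (auto simp: in_keys_iff)
      finally have 2: "nf_of ?N f c = (\<Sum>m\<in>K. lookup f m * ?N m c) + (if c \<in> C_mon P then lookup f c else 0)" .
      show ?thesis
      proof (cases "c \<in> C_mon P")
        case True
        then have "c \<notin> K" by (simp add: K_def E_mon_def)
        then have "lookup r c = (\<Sum>e\<in>K. - (lookup f e * ?N e c))"
          unfolding 1 by (intro sum.cong) auto
        then show ?thesis using True by (simp add: 2 lookup_minus sum_negf)
      next
        case False
        then have z: "?N e c = 0" for e using nf_shape_outside[OF s] by simp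
        have "lookup r c = (\<Sum>e\<in>K. if e = c then lookup f c else 0)"
          unfolding 1 by (intro sum.cong) (auto simp: z)
        also have "\<dots> = lookup f c" using False fK by (auto simp: K_def in_keys_iff)
        finally show ?thesis using False by (simp add: 2 lookup_minus z)
      qed
    qed
    have k: "keys (f - r) \<subseteq> C_mon P"
    proof
      fix c assume "c \<in> keys (f - r)"
      then have nz: "nf_of ?N f c \<noteq> 0" by (simp add: in_keys_iff l)
      show "c \<in> C_mon P"
      proof (rule ccontr)
        assume "c \<notin> C_mon P"
        then have "?N m c = 0" for m using nf_shape_outside[OF s] by simp
        then show False using nz by (simp add: nf_of_keys)
      qed
    qed
    have "f \<in> nf_ideal ?N \<longleftrightarrow> f - r = 0"
      by (simp add: nf_ideal_def poly_mapping_eq_iff fun_eq_iff flip: l)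
    also have "\<dots> \<longleftrightarrow> f \<in> I"
    proof
      assume "f - r = 0" then show "f \<in> I" using rI by simp
    next
      assume "f \<in> I"
      then have "f - r \<in> I" using rI id by (intro is_ideal_diff)
      then show "f - r = 0" using k by (rule cell_zero[OF assms])
    qed
    finally show ?thesis .
  qed
  then show ?thesis by blast
qed

text \<open>The step at \<open>v\<close> and \<open>m\<close> says that \<open>v\<close> times the reduced form of \<open>m\<close>, which lies in \<open>I\<close>, has
  normal form zero.\<close>
lemma is_nf_cell_nf:
  fixes I :: "'k::field poly2 set"
  assumes "is_partition P" "I \<in> jordan_cell P"
  shows "is_nf P (cell_nf P I)"
  unfolding is_nf_def
proof (intro conjI ballI)
  let ?N = "cell_nf P I"
  show s: "nf_shape P ?N" by (rule nf_shape_cell_nf)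
  fix v m c assume m: "m \<in> E_mon P" and c: "c \<in> C_mon P"
  let ?f = "nf_poly P ?N m"
  have "?f \<in> I" using nf_poly_in_ideal[OF s m] cell_eq_nf_ideal[OF assms] by simp
  then have "single v 1 * ?f \<in> I" using assms by (simp add: jordan_cell_iff graded_ideal_def is_ideal_iff)
  then have "nf_of ?N (single v 1 * ?f) c = 0"
    using cell_eq_nf_ideal[OF assms] by (auto simp: nf_ideal_def)
  then have 0: "linear_ext (\<lambda>a. a) (\<lambda>u. ?N (v + u) c) ?f = 0"
    by (simp add: nf_of_def linear_ext_single_mult[OF ring_map_id])
  have mC: "m \<notin> C_mon P" using m by (simp add: E_mon_def)
  have "keys ?f \<subseteq> insert m (C_mon P)"
    using keys_nf_poly[OF s m] by (auto simp: in_tails)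
  then have "linear_ext (\<lambda>a. a) (\<lambda>u. ?N (v + u) c) ?f = (\<Sum>u\<in>insert m (C_mon P). lookup ?f u * ?N (v + u) c)"
    by (intro linear_ext_superset[OF ring_map_id]) auto
  also have "\<dots> = ?N (v + m) c + (\<Sum>u\<in>C_mon P. lookup ?f u * ?N (v + u) c)"
    using mC by (simp add: lookup_nf_poly[OF s m])
  also have "(\<Sum>u\<in>C_mon P. lookup ?f u * ?N (v + u) c) = (\<Sum>u\<in>C_mon P. - (?N m u * ?N (v + u) c))"
    using mC by (intro sum.cong) (auto simp: lookup_nf_poly[OF s m])
  finally show "nf_step P ?N v m c" using 0 by (simp add: nf_step_def sum_negf)
qed

lemma cell_coord_nf_ideal:
  assumes "is_partition P" "is_nf P N"
  shows "cell_coord P (nf_ideal N) (m, c) = (if (m, c) \<in> tails P then - N m c else 0)"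
proof (cases "(m, c) \<in> tails P")
  case True
  have s: "nf_shape P N" using assms by (simp add: is_nf_def)
  have m: "m \<in> E_mon P" "c \<noteq> m" using True by (auto simp: in_tails)
  have "reduced_form P (nf_ideal N) m = nf_poly P N m"
    using keys_nf_poly[OF s m(1)]
    by (intro reduced_form(4)[OF assms(1) nf_ideal_in_cell[OF assms] m(1)] nf_poly_in_ideal[OF s m(1)])
      (auto simp: lookup_nf_poly[OF s m(1)] in_tails)
  then show ?thesis using True m by (simp add: cell_coord_eq lookup_nf_poly[OF s m(1)])
qed (simp add: cell_coord_eq)

lemma cell_coord_inject:
  assumes "is_partition P" "I \<in> jordan_cell P" "J \<in> jordan_cell P"
    and "\<And>m c. (m, c) \<in> tails P \<Longrightarrow> cell_coord P I (m, c) = cell_coord P J (m, c)"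
  shows "I = J"
proof -
  have "cell_coord P I (m, c) = cell_coord P J (m, c)" for m c
    using assms(4) by (cases "(m, c) \<in> tails P") (auto simp: cell_coord_eq)
  then have "cell_nf P I = cell_nf P J" by (simp add: cell_nf_def fun_eq_iff)
  then show ?thesis by (metis assms(1-3) cell_eq_nf_ideal)
qed

section \<open>Solving for the coordinates\<close>

text \<open>The entries at which neither \<open>(x m, x c)\<close> nor \<open>(m / y, c / y)\<close> is available. On a tail
  \<open>snd m > 0\<close>, so the subtraction is a genuine division by \<open>y\<close>.\<close>
definition free_tails :: "nat list \<Rightarrow> (monom2 \<times> monom2) set" where
  "free_tails P = {(m, c). (m, c) \<in> tails P \<and> var_x + c \<notin> C_mon P \<and> (fst m, snd m - 1) \<in> C_mon P}"

text \<open>The first recursive equation is the step at \<open>x\<close> from \<open>(m, c)\<close> to \<open>(x m, x c)\<close>, solved for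
  \<open>N m c\<close>. The second one is the step at \<open>y\<close> from \<open>m / y\<close> to \<open>m\<close>. In both cases the index sets of
  the sums leave out summands that vanish for any matrix of the right shape, which is
  what makes the recursion well-founded. The values \<open>l\<close> are the coordinates, hence the sign.\<close>
function nf_solution ::
  "nat list \<Rightarrow> (monom2 \<times> monom2 \<Rightarrow> 'r::comm_ring_1) \<Rightarrow> monom2 \<Rightarrow> monom2 \<Rightarrow> 'r" where
  "nf_solution P l m c =
    (if m \<in> C_mon P then of_bool (m = c)
     else if (m, c) \<notin> tails P then 0
     else if var_x + c \<in> C_mon P then
       nf_solution P l (var_x + m) (var_x + c) -
       (\<Sum>u\<in>{u \<in> C_mon P. var_x + u \<notin> C_mon P \<and> snd c < snd u \<and> snd u < snd m}.
          nf_solution P l m u * nf_solution P l (var_x + u) (var_x + c))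
     else if (fst m, snd m - 1) \<notin> C_mon P then
       (\<Sum>u\<in>{u \<in> C_mon P. snd c \<le> snd u + 1 \<and> snd u + 1 < snd m \<and> deg u + 1 = deg m}.
          nf_solution P l (fst m, snd m - 1) u * nf_solution P l (var_y + u) c)
     else - l (m, c))"
  by pat_completeness auto
termination
\<comment> \<open>The products have smaller drop. The entries \<open>(x m, x c)\<close> and \<open>(m / y, c / y)\<close> have the same
      drop; the first has larger \<open>x\<close>-degree, which is bounded on the diagram, the second smaller \<open>y\<close>-degree.\<close>
proof (relation "measures [\<lambda>(P, l, m, c). snd m - snd c, \<lambda>(P, l, m, c). (sum_list P - fst c) + snd m]", goal_cases)
  case (2 P l m c)
  then show ?case using fst_lt_sum_list[of "var_x + c" P] by simp
next
  case (5 P l m c u)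
  then have "fst u + snd u + 1 = fst c + snd c" by (simp add: in_tails deg_def)
  then show ?case using 5 by (auto simp: in_tails)
qed (auto simp: in_tails)

declare nf_solution.simps [simp del]

text \<open>The summand \<open>u = c\<close> is \<open>N m c\<close> because \<open>x c\<close> is its own normal form; the other summands with
  \<open>x u \<in> C\<close> vanish, and those with \<open>x u \<in> E\<close> vanish unless both factors have positive drop.\<close>
lemma sum_x_split:
  assumes "nf_shape P N" "m \<notin> C_mon P" "var_x + c \<in> C_mon P" "c \<in> C_mon P"
  shows "(\<Sum>u\<in>C_mon P. N m u * N (var_x + u) (var_x + c)) = N m c +
    (\<Sum>u\<in>{u \<in> C_mon P. var_x + u \<notin> C_mon P \<and> snd c < snd u \<and> snd u < snd m}.
      N m u * N (var_x + u) (var_x + c))"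
proof -
  let ?t = "\<lambda>u. N m u * N (var_x + u) (var_x + c)"
  let ?U = "\<lambda>u. var_x + u \<notin> C_mon P \<and> snd c < snd u \<and> snd u < snd m"
  have "?t u = (if u = c then N m c else 0) + (if ?U u then ?t u else 0)" if "u \<in> C_mon P" for u
  proof (cases "var_x + u \<in> C_mon P")
    case True
    then show ?thesis using assms(1) by (auto simp: nf_shape_C)
  next
    case False
    then have "u \<noteq> c" using assms(3) by auto
    moreover have "?t u = 0" if "\<not> ?U u"
    proof (cases "snd c < snd u")
      case True
      with that False have "(m, u) \<notin> tails P" by (auto simp: in_tails)
      then show ?thesis using assms by (simp add: nf_shape_E[of P N])
    next
      case no: False
      then have "(var_x + u, var_x + c) \<notin> tails P" by (auto simp: in_tails)
      then show ?thesis using assms False by (simp add: nf_shape_E[of P N])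
    qed
    ultimately show ?thesis by auto
  qed
  then have "(\<Sum>u\<in>C_mon P. ?t u) = (\<Sum>u\<in>C_mon P. (if u = c then N m c else 0) + (if ?U u then ?t u else 0))"
    by (intro sum.cong) auto
  also have "\<dots> = N m c + (\<Sum>u\<in>{u \<in> C_mon P. ?U u}. ?t u)"
    using assms(4) by (simp add: sum.distrib sum.inter_filter)
  finally show ?thesis .
qed

lemma sum_y_restrict:
  assumes "nf_shape P N" "m \<notin> C_mon P"
  shows "(\<Sum>u\<in>C_mon P. N m u * N (var_y + u) c) =
    (\<Sum>u\<in>{u \<in> C_mon P. snd c \<le> snd u + 1 \<and> snd u + 1 < snd m + 1 \<and> deg u + 1 = deg m + 1}.
      N m u * N (var_y + u) c)"
proof (rule sum.mono_neutral_right)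
  show "\<forall>u\<in>C_mon P - {u \<in> C_mon P. snd c \<le> snd u + 1 \<and> snd u + 1 < snd m + 1 \<and> deg u + 1 = deg m + 1}.
    N m u * N (var_y + u) c = 0"
  proof
    fix u assume u: "u \<in> C_mon P - {u \<in> C_mon P. snd c \<le> snd u + 1 \<and> snd u + 1 < snd m + 1 \<and> deg u + 1 = deg m + 1}"
    then consider "snd u + 1 < snd c" | "(m, u) \<notin> tails P" by (auto simp: in_tails)
    then show "N m u * N (var_y + u) c = 0"
    proof cases
      case 1
      then have "N (var_y + u) c = 0" by (intro nf_shape_snd[OF assms(1)]) simp
      then show ?thesis by simp
    next
      case 2
      then show ?thesis using assms by (simp add: nf_shape_E[of P N])
    qed
  qed
qed auto

lemma nf_shape_solution: "nf_shape P (nf_solution P l)"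
  unfolding nf_shape_def by (auto simp: nf_solution.simps[of P l])

lemma nf_solution_free: "(m, c) \<in> free_tails P \<Longrightarrow> nf_solution P l m c = - l (m, c)"
  by (auto simp: free_tails_def in_tails nf_solution.simps[of P l m c])

text \<open>Degrees are preserved and \<open>y\<close>-degrees decrease along \<open>m\<close>, \<open>u\<close> and along \<open>v u\<close>, \<open>c\<close>, strictly in
  the first case.\<close>
lemma nf_product_zero:
  assumes "nf_shape P N" "m \<notin> C_mon P" "u \<in> C_mon P"
    and "deg c \<noteq> deg v + deg m \<or> snd v + snd m \<le> snd c"
  shows "N m u * N (v + u) c = 0"
proof (rule ccontr)
  assume nz: "N m u * N (v + u) c \<noteq> 0"
  have "(m, u) \<in> tails P"
  proof (rule ccontr)
    assume "(m, u) \<notin> tails P"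
    then show False using nz assms(1,2) by (simp add: nf_shape_E[of P N])
  qed
  moreover have nz': "N (v + u) c \<noteq> 0" using nz by (metis mult_zero_right)
  then have "deg (v + u) = deg c" using nf_shape_deg[OF assms(1), of "v + u" c] by blast
  moreover have "\<not> snd (v + u) < snd c" using nz' nf_shape_snd[OF assms(1), of "v + u" c] by blast
  ultimately show False using assms(4) by (auto simp: in_tails)
qed

lemma nf_step_trivial:
  assumes "is_partition P" "nf_shape P N" "m \<notin> C_mon P"
    and "deg c \<noteq> deg v + deg m \<or> snd v + snd m \<le> snd c"
  shows "nf_step P N v m c"
proof -
  have "v + m \<notin> C_mon P" using C_mon_down[OF assms(1)] assms(3) by blast
  moreover have "(v + m, c) \<notin> tails P" using assms(4) by (auto simp: in_tails)
  ultimately have "N (v + m) c = 0" using assms(2) by (simp add: nf_shape_E[of P N])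
  moreover have "(\<Sum>u\<in>C_mon P. N m u * N (v + u) c) = 0"
    using nf_product_zero[OF assms(2,3) _ assms(4)] by (intro sum.neutral) auto
  ultimately show ?thesis by (simp add: nf_step_def)
qed

text \<open>Holds by construction where \<open>x\<close> divides \<open>c\<close>. If \<open>c\<close> is a power of \<open>y\<close> it does not precede \<open>x m\<close>,
  and both sides vanish.\<close>
lemma nf_solution_step_x:
  assumes "is_partition P"
  shows "nf_step P (nf_solution P l) var_x m c"
proof (rule nf_step_everywhere[OF nf_shape_solution])
  let ?N = "nf_solution P l"
  note s = nf_shape_solution[of P l]
  fix m c assume m: "m \<in> E_mon P" and c: "c \<in> C_mon P"
  show "nf_step P ?N var_x m c"
  proof (cases "deg c = 1 + deg m \<and> snd c < snd m")
    case False
    then show ?thesis using m by (intro nf_step_trivial[OF assms s]) auto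
  next
    case True
    then have "fst c \<noteq> 0" by (auto simp: deg_def)
    define b where "b = (fst c - 1, snd c)"
    have cb: "c = var_x + b" using \<open>fst c \<noteq> 0\<close> by (simp add: b_def prod_eq_iff)
    have b: "b \<in> C_mon P" using C_mon_down[OF assms, of "var_x" b] c by (simp add: cb)
    have t: "(m, b) \<in> tails P" using True m b by (auto simp: in_tails cb)
    have "?N m b = ?N (var_x + m) (var_x + b) -
       (\<Sum>u\<in>{u \<in> C_mon P. var_x + u \<notin> C_mon P \<and> snd b < snd u \<and> snd u < snd m}.
          ?N m u * ?N (var_x + u) (var_x + b))"
      using m t c by (subst nf_solution.simps) (simp add: cb)
    moreover have "(\<Sum>u\<in>C_mon P. ?N m u * ?N (var_x + u) (var_x + b)) = ?N m b +
       (\<Sum>u\<in>{u \<in> C_mon P. var_x + u \<notin> C_mon P \<and> snd b < snd u \<and> snd u < snd m}.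
          ?N m u * ?N (var_x + u) (var_x + b))"
      using m c b by (intro sum_x_split[OF s]) (simp_all add: cb)
    ultimately show ?thesis by (simp add: nf_step_def cb)
  qed
qed

text \<open>For a hand monomial \<open>c\<close> this is the recursion itself; suppose that \<open>x c \<in> C\<close>. Let \<open>L u\<close> and \<open>R u\<close> be the two sides of the
  step at \<open>y\<close> from \<open>m\<close> to \<open>(y m, u)\<close>. Reducing \<open>x y m\<close> once by way of \<open>y m\<close> and once by way of \<open>x m\<close>, and
  using the step at \<open>y\<close> for \<open>(x m, x c)\<close> and for \<open>x w\<close> with \<open>w\<close> preceding \<open>m\<close>, gives
  \<open>(\<Sum>u\<in>C. L u * K u) = (\<Sum>u\<in>C. R u * K u)\<close> with \<open>K u = N (x u) (x c)\<close>. The summands with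
  \<open>u \<noteq> c\<close> agree by induction on the drop, and \<open>K c = 1\<close>, so \<open>L c = R c\<close>.\<close>
lemma nf_solution_step_y:
  assumes "is_partition P"
  shows "nf_step P (nf_solution P l) var_y m c"
proof (rule nf_step_everywhere[OF nf_shape_solution])
  let ?N = "nf_solution P l"
  note s = nf_shape_solution[of P l]
  have X: "?N (var_x + m) c = (\<Sum>u\<in>C_mon P. ?N m u * ?N (var_x + u) c)" for m c
    by (rule nf_solution_step_x[OF assms, unfolded nf_step_def])
  fix m c assume "m \<in> E_mon P" "c \<in> C_mon P"
  then show "nf_step P ?N var_y m c"
  proof (induction "(m, c)" arbitrary: m c
      rule: wf_induct_rule[OF wf_measures[of "[\<lambda>(m, c). snd m + 1 - snd c, \<lambda>(m, c). sum_list P - fst c]"]])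
    case (1 m c)
    then have m: "m \<notin> C_mon P" and c: "c \<in> C_mon P" by simp_all
    have IH: "?N (var_y + m') c' = (\<Sum>u\<in>C_mon P. ?N m' u * ?N (var_y + u) c')"
      if "m' \<notin> C_mon P" "c' \<in> C_mon P"
        "((m', c'), (m, c)) \<in> measures [\<lambda>(m, c). snd m + 1 - snd c, \<lambda>(m, c). sum_list P - fst c]" for m' c'
      using 1(1)[OF that(3)] that by (simp add: nf_step_def)
    show ?case
    proof (cases "deg c = 1 + deg m \<and> snd c < 1 + snd m")
      case False
      then show ?thesis using m by (intro nf_step_trivial[OF assms s]) auto
    next
      case True
      have ym: "var_y + m \<notin> C_mon P" using C_mon_down[OF assms] m by blast
      have t: "(var_y + m, c) \<in> tails P" using True ym c by (auto simp: in_tails)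
      show ?thesis
      proof (cases "var_x + c \<in> C_mon P")
        case False
        have "?N (var_y + m) c = (\<Sum>u\<in>{u \<in> C_mon P. snd c \<le> snd u + 1 \<and> snd u + 1 < snd m + 1 \<and> deg u + 1 = deg m + 1}.
          ?N m u * ?N (var_y + u) c)"
          using False t ym m by (subst nf_solution.simps) simp
        then show ?thesis unfolding nf_step_def sum_y_restrict[OF s m] .
      next
        case xc: True
        let ?K = "\<lambda>u. ?N (var_x + u) (var_x + c)"
        let ?L = "\<lambda>u. ?N (var_y + m) u"
        let ?R = "\<lambda>u. \<Sum>w\<in>C_mon P. ?N m w * ?N (var_y + w) u"
        have fc: "fst c < sum_list P" using c by (rule fst_lt_sum_list)
        have xm: "var_x + m \<notin> C_mon P" using C_mon_down[OF assms] m by blast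
        have w: "?N m w * (\<Sum>t\<in>C_mon P. ?N (var_x + w) t * ?N (var_y + t) (var_x + c))
            = ?N m w * (\<Sum>u\<in>C_mon P. ?N (var_y + w) u * ?K u)" if "w \<in> C_mon P" for w
        proof (cases "(m, w) \<in> tails P")
          case False
          then show ?thesis using m by (simp add: nf_shape_E[OF s])
        next
          case mw: True
          have "?N (var_y + (var_x + w)) (var_x + c)
              = (\<Sum>t\<in>C_mon P. ?N (var_x + w) t * ?N (var_y + t) (var_x + c))"
          proof (cases "var_x + w \<in> C_mon P")
            case True
            then show ?thesis using nf_step_C[OF s True] by (simp add: nf_step_def)
          next
            case False
            then show ?thesis using mw xc True by (intro IH) (auto simp: in_tails)
          qed
          moreover have "?N (var_x + (var_y + w)) (var_x + c) = (\<Sum>u\<in>C_mon P. ?N (var_y + w) u * ?K u)"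
            by (rule X)
          moreover have "var_y + (var_x + w) = var_x + (var_y + w)" by (simp add: prod_eq_iff)
          ultimately show ?thesis by simp
        qed
        have "(\<Sum>u\<in>C_mon P. ?L u * ?K u) = ?N (var_x + (var_y + m)) (var_x + c)"
          by (rule X[symmetric])
        also have "var_x + (var_y + m) = var_y + (var_x + m)" by (simp add: prod_eq_iff)
        also have "?N (var_y + (var_x + m)) (var_x + c)
            = (\<Sum>t\<in>C_mon P. ?N (var_x + m) t * ?N (var_y + t) (var_x + c))"
          using xm xc fc by (intro IH) auto
        also have "\<dots> = (\<Sum>t\<in>C_mon P. \<Sum>w\<in>C_mon P. ?N m w * (?N (var_x + w) t * ?N (var_y + t) (var_x + c)))"
          by (subst X) (simp add: sum_distrib_right mult.assoc)
        also have "\<dots> = (\<Sum>w\<in>C_mon P. ?N m w * (\<Sum>t\<in>C_mon P. ?N (var_x + w) t * ?N (var_y + t) (var_x + c)))"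
          by (subst sum.swap) (simp add: sum_distrib_left)
        also have "\<dots> = (\<Sum>w\<in>C_mon P. ?N m w * (\<Sum>u\<in>C_mon P. ?N (var_y + w) u * ?K u))"
          by (intro sum.cong refl w)
        also have "\<dots> = (\<Sum>w\<in>C_mon P. \<Sum>u\<in>C_mon P. ?N m w * ?N (var_y + w) u * ?K u)"
          by (simp add: sum_distrib_left mult.assoc)
        also have "\<dots> = (\<Sum>u\<in>C_mon P. ?R u * ?K u)"
          by (subst sum.swap) (simp add: sum_distrib_right)
        finally have "(\<Sum>u\<in>C_mon P. ?L u * ?K u) = (\<Sum>u\<in>C_mon P. ?R u * ?K u)" .
        moreover have "?L u * ?K u = ?R u * ?K u" if u: "u \<in> C_mon P - {c}" for u
        proof (cases "?K u = 0")
          case False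
          have "var_x + u \<noteq> var_x + c" using u by simp
          then have "(var_x + u, var_x + c) \<in> tails P"
            using False nf_shape_C[OF s, of "var_x + u" "var_x + c"]
              nf_shape_E[OF s, of "var_x + u" "var_x + c"] by (auto simp del: add_left_cancel)
          then have "snd c < snd u" by (auto simp: in_tails)
          then have "?L u = ?R u" using u m True by (intro IH) auto
          then show ?thesis by simp
        qed simp
        then have "(\<Sum>u\<in>C_mon P - {c}. ?L u * ?K u) = (\<Sum>u\<in>C_mon P - {c}. ?R u * ?K u)"
          by (intro sum.cong refl)
        ultimately have "?L c * ?K c = ?R c * ?K c"
          using c by (simp add: sum.remove[of _ c])
        moreover have "?K c = 1" using xc by (simp add: nf_shape_C[OF s])
        ultimately show ?thesis by (simp add: nf_step_def)
      qed
    qed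
  qed
qed

lemma is_nf_solution: "is_partition P \<Longrightarrow> is_nf P (nf_solution P l)"
  unfolding is_nf_def using nf_shape_solution nf_solution_step_x nf_solution_step_y by auto

text \<open>Each equation of the recursion is one of the steps that every normal form system satisfies.\<close>
lemma nf_solution_unique:
  assumes "is_partition P" "is_nf P N" "\<And>m c. (m, c) \<in> free_tails P \<Longrightarrow> N m c = - l (m, c)"
  shows "N m c = nf_solution P l m c"
proof -
  have s: "nf_shape P N" using assms(2) by (simp add: is_nf_def)
  have "N m c = nf_solution P l m c" if "P' = P" "l' = l" for P' l'
    using that
  proof (induction P' l' m c rule: nf_solution.induct)
    case (1 P' l' m c)
    note P = \<open>P' = P\<close> \<open>l' = l\<close>
    note IH = 1(1-5)[unfolded P]
    show ?case
    proof (cases "m \<in> C_mon P \<or> (m, c) \<notin> tails P")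
      case True
      then show ?thesis
        using nf_shape_C[OF s, of m c] nf_shape_E[OF s, of m c] by (subst nf_solution.simps) auto
    next
      case False
      then have m: "m \<notin> C_mon P" and t: "(m, c) \<in> tails P" and c: "c \<in> C_mon P"
        by (auto simp: in_tails)
      show ?thesis
      proof (cases "var_x + c \<in> C_mon P")
        case True
        have "N (var_x + m) (var_x + c) = N m c +
            (\<Sum>u\<in>{u \<in> C_mon P. var_x + u \<notin> C_mon P \<and> snd c < snd u \<and> snd u < snd m}.
              N m u * N (var_x + u) (var_x + c))"
          using is_nf_step[OF assms(2), of "var_x" m "var_x + c"] sum_x_split[OF s m True c]
          by (simp add: nf_step_def)
        also have "N (var_x + m) (var_x + c) = nf_solution P l (var_x + m) (var_x + c)"
          using m t True by (intro IH) auto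
        also have "(\<Sum>u\<in>{u \<in> C_mon P. var_x + u \<notin> C_mon P \<and> snd c < snd u \<and> snd u < snd m}.
              N m u * N (var_x + u) (var_x + c)) =
            (\<Sum>u\<in>{u \<in> C_mon P. var_x + u \<notin> C_mon P \<and> snd c < snd u \<and> snd u < snd m}.
              nf_solution P l m u * nf_solution P l (var_x + u) (var_x + c))"
          using m t True by (intro sum.cong arg_cong2[where f = "(*)"] IH) auto
        finally show ?thesis using m t True by (subst nf_solution.simps) simp
      next
        case xc: False
        show ?thesis
        proof (cases "(fst m, snd m - 1) \<in> C_mon P")
          case True
          then have "(m, c) \<in> free_tails P" using t xc by (simp add: free_tails_def)
          then show ?thesis using assms(3) nf_solution_free by metis
        next
          case False
          let ?m = "(fst m, snd m - 1)"
          have sm: "snd m = Suc (snd m - 1)" using t by (simp add: in_tails)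
          then have ym: "m = var_y + ?m" by (simp add: prod_eq_iff)
          have dm: "deg m = deg ?m + 1" using sm by (simp add: deg_def)
          let ?U = "{u \<in> C_mon P. snd c \<le> snd u + 1 \<and> snd u + 1 < snd m \<and> deg u + 1 = deg m}"
          have "N m c = (\<Sum>u\<in>C_mon P. N ?m u * N (var_y + u) c)"
            using is_nf_step[OF assms(2), of "var_y" ?m c, unfolded nf_step_def, folded ym] by simp
          also have "\<dots> = (\<Sum>u\<in>?U. N ?m u * N (var_y + u) c)"
            using sum_y_restrict[OF s False, of c] sm dm by simp
          also have "\<dots> = (\<Sum>u\<in>?U. nf_solution P l ?m u * nf_solution P l (var_y + u) c)"
            using m t xc False by (intro sum.cong arg_cong2[where f = "(*)"] IH) auto
          finally show ?thesis using m t xc False by (subst nf_solution.simps) simp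
        qed
      qed
    qed
  qed
  then show ?thesis by simp
qed

text \<open>The recursion uses ring operations only.\<close>
lemma nf_solution_hom:
  assumes h: "ring_map h"
  shows "h (nf_solution P l m c) = nf_solution P (\<lambda>w. h (l w)) m c"
proof (induction P l m c rule: nf_solution.induct)
  case (1 P l m c)
  note IH = 1
  note hs = ring_map_diff[OF h] ring_map_minus[OF h] ring_map_sum[OF h] ring_map_mult[OF h] ring_map_0[OF h]
  have h1: "h 1 = 1" using h by (simp add: ring_map_def)
  consider "m \<in> C_mon P" | "m \<notin> C_mon P" "(m, c) \<notin> tails P"
    | "m \<notin> C_mon P" "(m, c) \<in> tails P" "var_x + c \<in> C_mon P"
    | "m \<notin> C_mon P" "(m, c) \<in> tails P" "var_x + c \<notin> C_mon P" "(fst m, snd m - 1) \<notin> C_mon P"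
    | "m \<notin> C_mon P" "(m, c) \<in> tails P" "var_x + c \<notin> C_mon P" "(fst m, snd m - 1) \<in> C_mon P"
    by blast
  then show ?case
  proof cases
    case 3
    have "h (nf_solution P l m c) = h (nf_solution P l (var_x + m) (var_x + c)) -
       (\<Sum>u\<in>{u \<in> C_mon P. var_x + u \<notin> C_mon P \<and> snd c < snd u \<and> snd u < snd m}.
          h (nf_solution P l m u) * h (nf_solution P l (var_x + u) (var_x + c)))"
      using 3 by (subst nf_solution.simps) (simp add: hs)
    also have "\<dots> = nf_solution P (\<lambda>w. h (l w)) (var_x + m) (var_x + c) -
       (\<Sum>u\<in>{u \<in> C_mon P. var_x + u \<notin> C_mon P \<and> snd c < snd u \<and> snd u < snd m}.
          nf_solution P (\<lambda>w. h (l w)) m u * nf_solution P (\<lambda>w. h (l w)) (var_x + u) (var_x + c))"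
      using 3 by (intro sum.cong arg_cong2[where f = "(*)"] arg_cong2[where f = "(-)"] IH) auto
    finally show ?thesis using 3 by (subst (2) nf_solution.simps) simp
  next
    case 4
    have "h (nf_solution P l m c) =
       (\<Sum>u\<in>{u \<in> C_mon P. snd c \<le> snd u + 1 \<and> snd u + 1 < snd m \<and> deg u + 1 = deg m}.
          h (nf_solution P l (fst m, snd m - 1) u) * h (nf_solution P l (var_y + u) c))"
      using 4 by (subst nf_solution.simps) (simp add: hs)
    also have "\<dots> =
       (\<Sum>u\<in>{u \<in> C_mon P. snd c \<le> snd u + 1 \<and> snd u + 1 < snd m \<and> deg u + 1 = deg m}.
          nf_solution P (\<lambda>w. h (l w)) (fst m, snd m - 1) u * nf_solution P (\<lambda>w. h (l w)) (var_y + u) c)"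
      using 4 by (intro sum.cong arg_cong2[where f = "(*)"] IH) auto
    finally show ?thesis using 4 by (subst (2) nf_solution.simps) simp
  qed (simp_all add: nf_solution.simps[of P _ m c] hs h1 of_bool_def)
qed

section \<open>Border monomials, hand monomials and component partitions\<close>

lemma hilbert_function_E_ideal:
  assumes "is_partition P"
  shows "hilbert_function (E_ideal P :: 'k::field poly2 set) i = card (C_mon P \<inter> monoms i)"
proof -
  have "(forms i :: 'k poly2 set) = supported (monoms i)" by (simp add: forms_def supported_def)
  moreover from this have "(E_ideal P :: 'k poly2 set) \<inter> forms i = supported (E_mon P \<inter> monoms i)"
    by (auto simp: E_ideal_eq[OF assms] supported_def)
  ultimately have "hilbert_function (E_ideal P :: 'k poly2 set) i = card (monoms i) - card (E_mon P \<inter> monoms i)"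
    by (simp add: hilbert_function_def lin_dim_supported)
  also have "\<dots> = card (monoms i - E_mon P \<inter> monoms i)"
    by (rule card_Diff_subset[symmetric]) auto
  also have "monoms i - E_mon P \<inter> monoms i = C_mon P \<inter> monoms i" by auto
  finally show ?thesis .
qed

lemma downward_nat_set:
  assumes "finite (A :: nat set)" "\<And>x y. x \<in> A \<Longrightarrow> y < x \<Longrightarrow> y \<in> A"
  shows "A = {..<card A}"
proof -
  obtain k where k: "k \<notin> A" using assms(1) ex_new_if_finite infinite_UNIV_nat by blast
  define l where "l = (LEAST k. k \<notin> A)"
  have "l \<notin> A" unfolding l_def using k by (rule LeastI)
  then have "A = {..<l}" using assms(2) not_less_Least[of _ "\<lambda>k. k \<notin> A", folded l_def]
    by (metis (no_types, lifting) lessThan_iff linorder_neqE_nat subsetI subset_antisym)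
  then show ?thesis by simp
qed

lemma partition_exists:
  assumes "finite D" "\<And>u w. u + w \<in> D \<Longrightarrow> w \<in> D"
  shows "\<exists>Q. is_partition Q \<and> C_mon Q = D"
proof -
  have down: "(a, b) \<in> D" if "(a', b') \<in> D" "a \<le> a'" "b \<le> b'" for a b a' b'
    using assms(2)[of "(a' - a, b' - b)" "(a, b)"] that by simp
  define row where "row b = {a. (a, b) \<in> D}" for b
  define col where "col = {b. (0, b) \<in> D}"
  have "finite (row b)" for b
    using finite_vimageI[OF assms(1), of "\<lambda>a. (a, b)"] by (simp add: row_def vimage_def inj_def)
  then have row: "row b = {..<card (row b)}" for b
    by (rule downward_nat_set) (auto simp: row_def intro: down)
  have "finite col"
    using finite_vimageI[OF assms(1), of "Pair 0"] by (simp add: col_def vimage_def inj_def)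
  then have col: "col = {..<card col}"
    by (rule downward_nat_set) (auto simp: col_def intro: down)
  have inD: "(a, b) \<in> D \<longleftrightarrow> a < card (row b)" for a b
    using row[of b] by (auto simp: row_def)
  have inD0: "(0, b) \<in> D \<longleftrightarrow> b < card col" for b
    using col by (auto simp: col_def)
  define Q where "Q = map (\<lambda>b. card (row b)) [0..<card col]"
  have "card (row b) \<le> card (row b')" if "b' \<le> b" for b b'
  proof (rule card_mono)
    show "finite (row b')" by fact
    show "row b \<subseteq> row b'" using that by (auto simp: row_def intro: down)
  qed
  then have "sorted_wrt (\<ge>) Q" by (auto simp: Q_def sorted_wrt_iff_nth_less)
  moreover have "0 \<notin> set Q" unfolding Q_def using inD0 inD by (metis (no_types, lifting) atLeastLessThan_iff imageE list.set_map set_upt order_less_irrefl)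
  moreover have "C_mon Q = D"
  proof (intro equalityI subrelI)
    fix a b assume "(a, b) \<in> C_mon Q"
    then show "(a, b) \<in> D" by (auto simp: C_mon_def Q_def inD)
  next
    fix a b assume ab: "(a, b) \<in> D"
    then have "b < card col" using down[of a b 0 b] inD0 by simp
    then show "(a, b) \<in> C_mon Q" using ab by (auto simp: C_mon_def Q_def inD)
  qed
  ultimately show ?thesis by (auto simp: is_partition_def)
qed

lemma C_mon_inject:
  assumes "is_partition Q" "is_partition Q'" "C_mon Q = C_mon Q'"
  shows "Q = Q'"
proof -
  have len: "b < length Q \<longleftrightarrow> (0, b) \<in> C_mon Q" if "is_partition Q" for Q b
  proof
    assume b: "b < length Q"
    then have "Q ! b \<noteq> 0" using that unfolding is_partition_def by (metis nth_mem)
    then show "(0, b) \<in> C_mon Q" using b by (simp add: C_mon_def)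
  qed (simp add: C_mon_def)
  have "b < length Q \<longleftrightarrow> b < length Q'" for b using len assms by simp
  then have l: "length Q = length Q'" by (metis linorder_neqE_nat order_less_irrefl)
  show ?thesis
  proof (rule nth_equalityI[OF l])
    fix b assume b: "b < length Q"
    have "a < Q ! b \<longleftrightarrow> a < Q' ! b" for a
    proof -
      have "(a, b) \<in> C_mon Q \<longleftrightarrow> (a, b) \<in> C_mon Q'" using assms(3) by simp
      then show ?thesis using b l by (simp add: C_mon_def)
    qed
    then show "Q ! b = Q' ! b" by (metis linorder_neqE_nat order_less_irrefl)
  qed
qed

subsection \<open>Ranks in a set of monomials of one degree\<close>

definition rank :: "monom2 set \<Rightarrow> monom2 \<Rightarrow> nat" where
  "rank M m = card {m' \<in> M. snd m' < snd m}"

lemma rank_less: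
  assumes "finite M" "m \<in> M" "snd m < snd m'"
  shows "rank M m < rank M m'"
  unfolding rank_def using assms by (intro psubset_card_mono) auto

lemma rank_less_iff:
  assumes "finite M" "m \<in> M" "m' \<in> M"
  shows "rank M m < rank M m' \<longleftrightarrow> snd m < snd m'"
proof
  assume r: "rank M m < rank M m'"
  show "snd m < snd m'"
  proof (rule ccontr)
    assume "\<not> snd m < snd m'"
    then consider "snd m' < snd m" | "snd m = snd m'" by linarith
    then show False
    proof cases
      case 1
      then show ?thesis using rank_less[OF assms(1,3) 1] r by simp
    next
      case 2
      then show ?thesis using r by (simp add: rank_def)
    qed
  qed
qed (rule rank_less[OF assms(1,2)])

lemma bij_betw_rank:
  assumes "M \<subseteq> monoms i"
  shows "bij_betw (rank M) M {..<card M}"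
proof -
  have fin: "finite M" using assms finite_monoms finite_subset by blast
  have inj: "inj_on (rank M) M"
  proof (rule inj_onI)
    fix m m' assume m: "m \<in> M" "m' \<in> M" "rank M m = rank M m'"
    then have "snd m = snd m'"
      using rank_less_iff[OF fin, of m m'] rank_less_iff[OF fin, of m' m] by simp
    moreover have "deg m = deg m'" using m assms by (auto simp: subset_iff)
    ultimately show "m = m'" by (intro monom_eqI)
  qed
  have "rank M m < card M" if "m \<in> M" for m
    unfolding rank_def using fin that by (intro psubset_card_mono) auto
  then have "rank M ` M \<subseteq> {..<card M}" by auto
  moreover have "card (rank M ` M) = card {..<card M}" using card_image[OF inj] by simp
  ultimately have "rank M ` M = {..<card M}" by (intro card_subset_eq) auto
  with inj show ?thesis by (simp add: bij_betw_def)
qed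

lemma card_first_monoms:
  assumes "M \<subseteq> monoms i" "n \<le> card M"
  shows "card (first_monoms n M) = n"
proof -
  note b = bij_betw_rank[OF assms(1)]
  have "rank M ` first_monoms n M = {..<n}"
  proof (intro equalityI subsetI)
    fix r assume "r \<in> {..<n}"
    then have "r \<in> rank M ` M" using b assms(2) by (auto simp: bij_betw_def)
    then show "r \<in> rank M ` first_monoms n M"
      using \<open>r \<in> {..<n}\<close> by (auto simp: first_monoms_def rank_def)
  qed (auto simp: first_monoms_def rank_def)
  moreover have "inj_on (rank M) (first_monoms n M)"
    using b by (auto simp: bij_betw_def first_monoms_def inj_on_def)
  ultimately show ?thesis by (metis card_image card_lessThan)
qed

definition diag_monom :: "nat \<Rightarrow> nat \<Rightarrow> monom2" where
  "diag_monom n r = (n - r, r)"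

lemma bij_betw_diag_monom: "bij_betw (diag_monom n) {..<Suc n} (monoms n)"
  unfolding monoms_conv diag_monom_def lessThan_Suc_atMost
  by (rule inj_on_imp_bij_betw) (auto simp: inj_on_def)

text \<open>The predecessors of \<open>m\<close> in \<open>V\<close> correspond to those of \<open>g m\<close> among the monomials of degree \<open>n\<close>,
  and a monomial of degree \<open>n\<close> has as many predecessors as its \<open>y\<close>-degree.\<close>
lemma increasing_bij_unique:
  assumes V: "V \<subseteq> monoms i" and g: "bij_betw g V (monoms n)"
    and mono: "\<And>m m'. m \<in> V \<Longrightarrow> m' \<in> V \<Longrightarrow> snd m < snd m' \<Longrightarrow> snd (g m) < snd (g m')"
    and m: "m \<in> V"
  shows "g m = diag_monom n (rank V m)"
proof -
  have mono_iff: "snd (g u) < snd (g m) \<longleftrightarrow> snd u < snd m" if u: "u \<in> V" for u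
  proof
    assume less: "snd (g u) < snd (g m)"
    show "snd u < snd m"
    proof (rule ccontr)
      assume "\<not> snd u < snd m"
      then consider "snd m < snd u" | "snd u = snd m" by linarith
      then show False
      proof cases
        case 1
        then show ?thesis using mono[OF m u] less by simp
      next
        case 2
        moreover have "deg u = deg m" using u m V by (auto simp: subset_iff)
        ultimately show ?thesis using monom_eqI[of u m] less by simp
      qed
    qed
  qed (rule mono[OF u m])
  have gm: "deg (g m) = n" using bij_betwE[OF g] m by simp
  have "rank V m = card (g ` {u \<in> V. snd u < snd m})"
    unfolding rank_def using g by (intro card_image[symmetric]) (auto simp: bij_betw_def inj_on_def)
  also have "g ` {u \<in> V. snd u < snd m} = {w \<in> monoms n. snd w < snd (g m)}"
  proof (intro equalityI subsetI)
    fix w assume w: "w \<in> {w \<in> monoms n. snd w < snd (g m)}"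
    then obtain u where u: "u \<in> V" "w = g u" using bij_betw_imp_surj_on[OF g] by blast
    then show "w \<in> g ` {u \<in> V. snd u < snd m}" using w mono_iff[OF u(1)] by simp
  next
    fix w assume "w \<in> g ` {u \<in> V. snd u < snd m}"
    then obtain u where u: "u \<in> V" "w = g u" "snd u < snd m" by blast
    then show "w \<in> {w \<in> monoms n. snd w < snd (g m)}"
      using mono_iff[OF u(1)] bij_betwE[OF g] by simp
  qed
  also have "\<dots> = diag_monom n ` {..<snd (g m)}"
  proof (intro equalityI subsetI)
    fix w assume w: "w \<in> {w \<in> monoms n. snd w < snd (g m)}"
    then have "w = diag_monom n (snd w)" by (auto simp: diag_monom_def deg_def prod_eq_iff)
    then show "w \<in> diag_monom n ` {..<snd (g m)}" using w by blast
  qed (use gm in \<open>auto simp: diag_monom_def deg_def\<close>)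
  also have "card \<dots> = snd (g m)" by (subst card_image) (auto simp: inj_on_def diag_monom_def)
  finally show ?thesis using gm by (simp add: diag_monom_def prod_eq_iff deg_def)
qed

subsection \<open>The monomials of one degree\<close>

text \<open>What the hypotheses on the diagonal lengths amount to in a single degree \<open>i\<close> with
  \<open>d \<le> i \<le> j\<close>.\<close>
locale jordan_degree =
  fixes P :: "nat list" and T :: "nat \<Rightarrow> nat" and i :: nat
  assumes partition: "is_partition P"
    and T: "\<And>i. T i = card (C_mon P \<inter> monoms i)"
    and i_pos: "0 < i"
    and T_pos: "0 < T i"
    and T_prev: "T i \<le> T (i - 1)"
    and T_next: "T (i + 1) \<le> T i"
begin

abbreviation n where "n \<equiv> comp_deg T i"
abbreviation A where "A \<equiv> horizontal_border P i"
abbreviation H where "H \<equiv> hands P i"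
abbreviation V where "V \<equiv> V1 P i \<union> V2 T P i"
abbreviation s where "s \<equiv> s_map T P i"

lemma in_A: "m \<in> A \<longleftrightarrow> deg m = i \<and> m \<notin> C_mon P \<and> 0 < snd m \<and> (fst m, snd m - 1) \<in> C_mon P"
  by (cases m) (auto simp: horizontal_border_def)

lemma in_H: "c \<in> H \<longleftrightarrow> deg c = i \<and> c \<in> C_mon P \<and> var_x + c \<notin> C_mon P"
  by (cases c) (auto simp: hands_def var_x_def)

lemma A_subset: "A \<subseteq> monoms i" and H_subset: "H \<subseteq> monoms i"
  by (auto simp: in_A in_H)

lemma finite_A: "finite A" and finite_H: "finite H"
  using finite_subset[OF A_subset] finite_subset[OF H_subset] by simp_all

lemma down: "u + w \<in> C_mon P \<Longrightarrow> w \<in> C_mon P"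
  by (rule C_mon_down[OF partition])

lemma down_pair: "(a', b') \<in> C_mon P \<Longrightarrow> a \<le> a' \<Longrightarrow> b \<le> b' \<Longrightarrow> (a, b) \<in> C_mon P"
  using down[of "(a' - a, b' - b)" "(a, b)"] by simp

text \<open>Multiplication by \<open>y\<close> maps the degree \<open>i - 1\<close> part of \<open>C\<close> bijectively onto the border monomials
  together with the degree \<open>i\<close> part of \<open>C\<close>, except for \<open>x^i\<close>.\<close>
lemma card_A: "card A + T i = T (i - 1) + of_bool ((i, 0) \<in> C_mon P)"
proof -
  let ?Y = "(+) var_y ` (C_mon P \<inter> monoms (i - 1))"
  let ?X = "{(i, 0)} \<inter> C_mon P"
  have "A \<union> (C_mon P \<inter> monoms i) = ?Y \<union> ?X"
  proof (intro equalityI subsetI)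
    fix m assume m: "m \<in> A \<union> (C_mon P \<inter> monoms i)"
    show "m \<in> ?Y \<union> ?X"
    proof (cases "snd m = 0")
      case True
      then show ?thesis using m by (cases m) (auto simp: in_A)
    next
      case False
      let ?m = "(fst m, snd m - 1)"
      have "m = var_y + ?m" using False by (simp add: prod_eq_iff)
      moreover have "?m \<in> C_mon P" using m down_pair[of "fst m" "snd m" "fst m" "snd m - 1"] by (auto simp: in_A)
      moreover have "deg ?m = i - 1" using m False by (auto simp: in_A deg_def)
      ultimately show ?thesis by auto
    qed
  next
    fix m assume "m \<in> ?Y \<union> ?X"
    then show "m \<in> A \<union> (C_mon P \<inter> monoms i)"
    proof
      assume "m \<in> ?Y"
      then obtain u where "m = var_y + u" "u \<in> C_mon P" "deg u = i - 1" by auto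
      then show ?thesis using i_pos by (auto simp: in_A)
    qed auto
  qed
  moreover have "card (A \<union> (C_mon P \<inter> monoms i)) = card A + T i"
    unfolding T using finite_A by (intro card_Un_disjoint) (auto simp: in_A)
  moreover have "card (?Y \<union> ?X) = card ?Y + card ?X"
    by (intro card_Un_disjoint) (auto simp: prod_eq_iff)
  moreover have "card ?Y = T (i - 1)" unfolding T by (intro card_image) (auto simp: inj_on_def)
  moreover have "card ?X = of_bool ((i, 0) \<in> C_mon P)" by auto
  ultimately show ?thesis by simp
qed

text \<open>Multiplication by \<open>x\<close> maps the degree \<open>i\<close> part of \<open>C\<close> onto the multiples of hand monomials
  together with the degree \<open>i + 1\<close> part of \<open>C\<close>, except for \<open>y^(i + 1)\<close>.\<close>
lemma card_H: "card H + T (i + 1) = T i + of_bool ((0, i + 1) \<in> C_mon P)"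
proof -
  let ?X = "(+) var_x ` (C_mon P \<inter> monoms i)"
  let ?Y = "{(0, i + 1)} \<inter> C_mon P"
  let ?H = "(+) var_x ` H"
  have "?H \<union> (C_mon P \<inter> monoms (i + 1)) = ?X \<union> ?Y"
  proof (intro equalityI subsetI)
    fix m assume m: "m \<in> ?H \<union> (C_mon P \<inter> monoms (i + 1))"
    show "m \<in> ?X \<union> ?Y"
    proof (cases "fst m = 0")
      case True
      then show ?thesis using m by (cases m) (auto simp: in_H)
    next
      case False
      show ?thesis
      proof (cases "m \<in> ?H")
        case False
        let ?m = "(fst m - 1, snd m)"
        have e: "m = var_x + ?m" using \<open>fst m \<noteq> 0\<close> by (simp add: prod_eq_iff)
        moreover have "?m \<in> C_mon P" using m False down[of var_x ?m] e by auto
        moreover have "deg ?m = i" using m False \<open>fst m \<noteq> 0\<close> by (auto simp: deg_def)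
        ultimately show ?thesis by auto
      qed (auto simp: in_H)
    qed
  next
    fix m assume "m \<in> ?X \<union> ?Y"
    then show "m \<in> ?H \<union> (C_mon P \<inter> monoms (i + 1))"
    proof
      assume "m \<in> ?X"
      then obtain u where u: "m = var_x + u" "u \<in> C_mon P" "deg u = i" by auto
      then have "var_x + u \<notin> C_mon P \<Longrightarrow> u \<in> H" by (simp add: in_H)
      then show ?thesis using u by auto
    qed auto
  qed
  moreover have "card (?H \<union> (C_mon P \<inter> monoms (i + 1))) = card ?H + T (i + 1)"
    unfolding T using finite_H by (intro card_Un_disjoint) (auto simp: in_H)
  moreover have "card ?H = card H" by (intro card_image) (auto simp: inj_on_def)
  moreover have "card (?X \<union> ?Y) = card ?X + card ?Y"
    by (intro card_Un_disjoint) (auto simp: prod_eq_iff)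
  moreover have "card ?X = T i" unfolding T by (intro card_image) (auto simp: inj_on_def)
  moreover have "card ?Y = of_bool ((0, i + 1) \<in> C_mon P)" by auto
  ultimately show ?thesis by simp
qed

text \<open>Walk along the diagonal from \<open>c\<close> towards \<open>m\<close>. The first monomial \<open>h\<close> outside the diagram comes
  right after one inside it, hence \<open>h / y\<close> is in the diagram.\<close>
lemma border_between:
  assumes "c \<in> C_mon P" "deg c = i" "m \<notin> C_mon P" "deg m = i" "snd c < snd m"
  shows "\<exists>h\<in>A. snd c < snd h \<and> snd h \<le> snd m"
proof -
  let ?R = "\<lambda>b. snd c < b \<and> b \<le> snd m \<and> (i - b, b) \<notin> C_mon P"
  have "m = (i - snd m, snd m)" using assms(4) by (auto simp: deg_def prod_eq_iff)
  then have R: "?R (snd m)" using assms by auto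
  define b where "b = (LEAST b. ?R b)"
  have b: "?R b" unfolding b_def using R by (rule LeastI)
  have bi: "b \<le> i" using b assms(4) by (simp add: deg_def)
  have "(i - (b - 1), b - 1) \<in> C_mon P"
  proof (cases "b - 1 = snd c")
    case True
    then have "(i - (b - 1), b - 1) = c" using assms(2) by (auto simp: deg_def prod_eq_iff)
    then show ?thesis using assms(1) by simp
  next
    case False
    have "\<not> ?R (b - 1)" by (rule not_less_Least[of "b - 1" ?R, folded b_def]) (use b in simp)
    then show ?thesis using b False by auto
  qed
  then have "(i - b, b - 1) \<in> C_mon P" by (rule down_pair) auto
  then have "(i - b, b) \<in> A" using b bi by (simp add: in_A)
  then show ?thesis using b by (intro bexI[of _ "(i - b, b)"]) auto
qed

text \<open>The vertical-border monomial that belongs to \<open>V\<^sub>i\<^sub>1\<close> when \<open>x^i\<close> is not in the diagram.\<close>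
definition extra_border where
  "extra_border = arg_max_on snd {v \<in> vertical_border P i. \<forall>h \<in> A. snd v < snd h}"

lemma extra_border:
  assumes "(i, 0) \<notin> C_mon P"
  shows "extra_border \<in> vertical_border P i" "\<And>h. h \<in> A \<Longrightarrow> snd extra_border < snd h"
proof -
  let ?S = "\<lambda>v. v \<in> {v \<in> vertical_border P i. \<forall>h \<in> A. snd v < snd h}"
  have "C_mon P \<inter> monoms i \<noteq> {}" using T_pos unfolding T by force
  then obtain c where "c \<in> C_mon P \<inter> monoms i" by blast
  then have c: "c \<in> C_mon P" "deg c = i" by simp_all
  \<comment> \<open>The set of candidates is nonempty: if \<open>w\<close> is the first monomial of degree \<open>i - 1\<close> in the
      diagram, then \<open>x w\<close> is a vertical-border monomial, and it precedes every border monomial \<open>h\<close>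
      because \<open>h / y\<close> does not precede \<open>w\<close>.\<close>
  let ?R = "\<lambda>b. b \<le> i - 1 \<and> (i - 1 - b, b) \<in> C_mon P"
  have c0: "snd c \<noteq> 0"
  proof
    assume "snd c = 0"
    then have "c = (i, 0)" using c(2) by (simp add: deg_def prod_eq_iff)
    then show False using c(1) assms by simp
  qed
  have ci: "snd c \<le> i" "fst c = i - snd c" using c(2) by (auto simp: deg_def)
  have "(i - 1 - (snd c - 1), snd c - 1) \<in> C_mon P"
  proof (rule down_pair)
    show "(fst c, snd c) \<in> C_mon P" using c(1) by simp
  qed (use c0 ci in simp_all)
  then have R: "?R (snd c - 1)" using ci by auto
  define b where "b = (LEAST b. ?R b)"
  have b: "?R b" unfolding b_def using R by (rule LeastI)
  have least: "b \<le> b'" if "?R b'" for b' unfolding b_def using that by (rule Least_le)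
  have "(i - b, b) \<notin> C_mon P"
  proof
    assume C: "(i - b, b) \<in> C_mon P"
    have "b \<noteq> 0"
    proof
      assume "b = 0"
      then show False using C assms by simp
    qed
    moreover have "(i - b, b - 1) \<in> C_mon P" using C by (rule down_pair) auto
    ultimately have "?R (b - 1)" using b by auto
    then show False using least[of "b - 1"] \<open>b \<noteq> 0\<close> by simp
  qed
  then have "(i - b, b) \<in> vertical_border P i"
    using b i_pos by (auto simp: vertical_border_def)
  moreover have "b < snd h" if "h \<in> A" for h
  proof -
    have "(fst h, snd h - 1) \<in> C_mon P" "deg h = i" "0 < snd h" using that by (auto simp: in_A)
    then have "?R (snd h - 1)" by (auto simp: deg_def)
    from least[OF this] \<open>0 < snd h\<close> show ?thesis by simp
  qed
  ultimately have "?S (i - b, b)" by simp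
  moreover have "\<forall>v. ?S v \<longrightarrow> snd v < i + 1" by (auto simp: vertical_border_def)
  ultimately have "?S extra_border" unfolding extra_border_def arg_max_on_def by (rule arg_max_natI)
  then show "extra_border \<in> vertical_border P i" "\<And>h. h \<in> A \<Longrightarrow> snd extra_border < snd h" by auto
qed

lemma V1_eq: "V1 P i = (if (i, 0) \<in> C_mon P then A else insert extra_border A)"
  by (simp add: V1_def extra_border_def)

lemma V1_E: "m \<in> V1 P i \<Longrightarrow> deg m = i \<and> m \<notin> C_mon P"
  using extra_border(1) by (auto simp: V1_eq in_A vertical_border_def split: if_splits)

lemma A_subset_V1: "A \<subseteq> V1 P i"
  by (auto simp: V1_eq)

text \<open>If a monomial of the diagram preceded the extra monomial of \<open>V\<^sub>i\<^sub>1\<close>, there would be a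
  horizontal-border monomial between them, contrary to the choice of the extra monomial.\<close>
lemma V1_tail:
  assumes "m \<in> V1 P i" "c \<in> C_mon P" "deg c = i" "snd c < snd m"
  shows "m \<in> A"
proof (rule ccontr)
  assume "m \<notin> A"
  then have m: "m = extra_border" "(i, 0) \<notin> C_mon P" using assms(1) by (auto simp: V1_eq split: if_splits)
  obtain h where "h \<in> A" "snd h \<le> snd m"
    using border_between[OF assms(2,3), of m] V1_E[OF assms(1)] assms(4) by auto
  then show False using extra_border(2)[OF m(2), of h] m(1) by simp
qed

lemma card_V1: "card (V1 P i) = delta T i + 1"
proof (cases "(i, 0) \<in> C_mon P")
  case True
  then show ?thesis using card_A T_prev by (simp add: V1_eq delta_def)
next
  case False
  then have "extra_border \<notin> A" using extra_border(2) by blast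
  then show ?thesis using False card_A T_prev finite_A by (simp add: V1_eq delta_def)
qed

lemma V2_subset_H: "V2 T P i \<subseteq> H"
  by (auto simp: V2_def first_monoms_def)

lemma V2_C: "c \<in> V2 T P i \<Longrightarrow> deg c = i \<and> c \<in> C_mon P"
  using V2_subset_H by (auto simp: in_H)

lemma card_V2: "card (V2 T P i) = delta T (i + 1)"
  unfolding V2_def using card_H T_next by (intro card_first_monoms[OF H_subset]) (simp add: delta_def)

text \<open>At most the last hand monomial is missing from \<open>V\<^sub>i\<^sub>2\<close>, and only if \<open>y^(i + 1)\<close> is in the
  diagram. Then the diagonal ends inside the diagram, so after the last monomial outside the diagram
  there is another hand monomial, and \<open>c\<close> is not the last one.\<close>
lemma free_hand_in_V2:
  assumes "c \<in> H" "m \<notin> C_mon P" "deg m = i" "snd c < snd m"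
  shows "c \<in> V2 T P i"
proof (cases "(0, i + 1) \<in> C_mon P")
  case False
  then have "card (V2 T P i) = card H" using card_V2 card_H by (simp add: delta_def)
  then have "V2 T P i = H" by (intro card_subset_eq finite_H V2_subset_H)
  then show ?thesis using assms(1) by simp
next
  case True
  let ?R = "\<lambda>b. b \<le> i \<and> (i - b, b) \<notin> C_mon P"
  have "m = (i - snd m, snd m)" using assms(3) by (auto simp: deg_def prod_eq_iff)
  then have R: "?R (snd m)" using assms by (auto simp: deg_def)
  define b where "b = (GREATEST b. ?R b)"
  have bound: "\<And>y. ?R y \<Longrightarrow> y \<le> i" by simp
  have b: "?R b" unfolding b_def using R bound by (rule GreatestI_nat)
  have greatest: "b' \<le> b" if "?R b'" for b'
    unfolding b_def using that bound by (rule Greatest_le_nat)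
  have "(0, i) \<in> C_mon P" using True by (rule down_pair) auto
  then have bi: "b < i" using b by (cases "b = i") auto
  let ?c = "(i - (b + 1), b + 1)"
  have "?c \<in> C_mon P" using greatest[of "b + 1"] bi by auto
  moreover have "var_x + ?c \<notin> C_mon P"
  proof
    assume "var_x + ?c \<in> C_mon P"
    moreover have "var_x + ?c = (i - b, b + 1)" using bi by (simp add: var_x_def)
    ultimately have "(i - b, b) \<in> C_mon P" using down_pair[of "i - b" "b + 1" "i - b" b] by simp
    then show False using b by simp
  qed
  ultimately have cH: "?c \<in> H" using bi by (simp add: in_H)
  moreover have "snd c < snd ?c" using greatest[OF R] assms(4) by simp
  ultimately have "rank H c < rank H ?c" using assms(1) finite_H by (intro rank_less)
  moreover have "rank H ?c < card H" using bij_betwE[OF bij_betw_rank[OF H_subset]] cH by blast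
  moreover have "card H = delta T (i + 1) + 1" using card_H True T_next by (simp add: delta_def)
  ultimately show ?thesis using assms(1) by (simp add: V2_def first_monoms_def rank_def)
qed

text \<open>The free entries of degree \<open>i\<close> are exactly those that the \<open>i\<close>-th component records.\<close>
lemma free_tails_eq:
  assumes "deg m = i"
  shows "(m, c) \<in> free_tails P \<longleftrightarrow> m \<in> V1 P i \<and> c \<in> V2 T P i \<and> snd c < snd m"
proof
  assume "(m, c) \<in> free_tails P"
  then have f: "m \<notin> C_mon P" "c \<in> C_mon P" "deg c = i" "snd c < snd m" "var_x + c \<notin> C_mon P"
    "(fst m, snd m - 1) \<in> C_mon P"
    using assms by (auto simp: free_tails_def in_tails)
  then have "m \<in> A" "c \<in> H" using assms by (auto simp: in_A in_H)
  then show "m \<in> V1 P i \<and> c \<in> V2 T P i \<and> snd c < snd m"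
    using A_subset_V1 free_hand_in_V2 f assms by blast
next
  assume a: "m \<in> V1 P i \<and> c \<in> V2 T P i \<and> snd c < snd m"
  then have "c \<in> H" using V2_subset_H by blast
  moreover from this have "m \<in> A" using V1_tail[of m c] a by (simp add: in_H)
  ultimately show "(m, c) \<in> free_tails P"
    using a by (auto simp: free_tails_def in_tails in_A in_H)
qed

subsection \<open>The component partition\<close>

lemma V_subset: "V \<subseteq> monoms i"
  using V1_E V2_C by auto

lemma finite_V: "finite V"
  using V_subset finite_monoms finite_subset by blast

lemma V_disjoint: "V1 P i \<inter> V2 T P i = {}"
  using V1_E V2_C by blast

lemma card_V: "card V = Suc n"
  using finite_V V_disjoint by (simp add: card_Un_disjoint card_V1 card_V2 comp_deg_def)

lemma s_map_eq: "m \<in> V \<Longrightarrow> s m = diag_monom n (rank V m)"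
  and s_bij: "bij_betw s V (monoms n)"
proof -
  let ?p = "\<lambda>g. g \<in> extensional V \<and> bij_betw g V (monoms n) \<and>
     (\<forall>m \<in> V. \<forall>m' \<in> V. snd m < snd m' \<longrightarrow> snd (g m) < snd (g m'))"
  let ?g = "restrict (\<lambda>m. diag_monom n (rank V m)) V"
  have "bij_betw (diag_monom n \<circ> rank V) V (monoms n)"
    using bij_betw_rank[OF V_subset] bij_betw_diag_monom[of n] unfolding card_V
    by (rule bij_betw_trans)
  then have bij: "bij_betw ?g V (monoms n)"
    by (subst bij_betw_restrict_eq) (simp add: comp_def)
  have 1: "?p ?g"
    using bij rank_less[OF finite_V] by (auto simp: diag_monom_def)
  have "s = ?g"
    unfolding s_map_def
  proof (rule the_equality)
    fix g assume g: "?p g"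
    show "g = ?g"
    proof (rule extensionalityI[of _ V])
      fix m assume "m \<in> V"
      then show "g m = ?g m" using increasing_bij_unique[OF V_subset, of g n m] g by simp
    qed (use g in auto)
  qed (rule 1)
  then show "m \<in> V \<Longrightarrow> s m = diag_monom n (rank V m)" "bij_betw s V (monoms n)"
    using bij by simp_all
qed

lemma s_snd: "m \<in> V \<Longrightarrow> m' \<in> V \<Longrightarrow> snd (s m) < snd (s m') \<longleftrightarrow> snd m < snd m'"
  using rank_less_iff[OF finite_V] by (simp add: s_map_eq diag_monom_def)

lemma s_deg: "m \<in> V \<Longrightarrow> deg (s m) = n"
  using bij_betwE[OF s_bij] by simp

lemma s_inj: "m \<in> V \<Longrightarrow> m' \<in> V \<Longrightarrow> s m = s m' \<longleftrightarrow> m = m'"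
  using s_bij by (auto simp: bij_betw_def inj_on_eq_iff)

text \<open>The ideal that defines the component is spanned by the monomials \<open>s m\<close> with \<open>m \<in> V\<^sub>i\<^sub>1\<close> and
  everything of degree above \<open>n\<close>. Its complement contains all monomials
  of degree below \<open>n\<close> and none above; any such set is closed under divisors, hence the diagram
  of a partition.\<close>
lemma component:
  defines "Q \<equiv> component TYPE('k::field) T P i"
  shows "is_partition Q" "C_mon Q = {m. deg m < n} \<union> s ` V2 T P i"
proof -
  let ?D = "{m. deg m < n} \<union> s ` V2 T P i"
  let ?J = "ideal_gen (mon ` s ` V1 P i) + ideal_power max_ideal (n + 1) :: 'k poly2 set"
  have sV: "s ` V1 P i \<union> s ` V2 T P i = monoms n" using s_bij by (auto simp: bij_betw_def image_Un)
  have sd: "s ` V1 P i \<inter> s ` V2 T P i = {}" using V_disjoint s_inj by auto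
  have "{w + g | w g. g \<in> s ` V1 P i} \<union> {m. n + 1 \<le> deg m} = - ?D" (is "?S = _")
  proof (intro equalityI subsetI)
    fix m assume "m \<in> ?S"
    then show "m \<in> - ?D"
    proof
      assume "m \<in> {w + g | w g. g \<in> s ` V1 P i}"
      then obtain w g where m: "m = w + g" "g \<in> s ` V1 P i" by blast
      then have g: "deg g = n" "g \<notin> s ` V2 T P i" using sV sd by auto
      show ?thesis
      proof (cases "deg w = 0")
        case True
        then have "w = 0" by (simp add: deg_def prod_eq_iff)
        then show ?thesis using g m by auto
      next
        case False
        then have "n < deg m" using g m by simp
        then show ?thesis using s_deg by force
      qed
    qed (use s_deg in auto)
  next
    fix m assume m: "m \<in> - ?D"
    then consider "n + 1 \<le> deg m" | "deg m = n" by force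
    then show "m \<in> ?S"
    proof cases
      case 2
      then have "m = 0 + m \<and> m \<in> s ` V1 P i" using m sV by auto
      then show ?thesis by blast
    qed simp
  qed
  then have J: "?J = supported (- ?D)"
    by (simp only: ideal_gen_mon ideal_power_max_ideal supported_plus)
  have "?D \<subseteq> (\<Union>k\<le>n. monoms k)" using s_deg by auto
  then have "finite ?D" by (rule finite_subset) simp
  moreover have "w \<in> ?D" if "u + w \<in> ?D" for u w
  proof (cases "deg u = 0")
    case True
    then have "u = 0" by (simp add: deg_def prod_eq_iff)
    then show ?thesis using that by simp
  next
    case False
    have "deg (u + w) \<le> n" using that s_deg by fastforce
    then show ?thesis using False by simp
  qed
  ultimately obtain Q' where Q': "is_partition Q'" "C_mon Q' = ?D"
    using partition_exists[of ?D] by blast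
  have "Q = Q'"
    unfolding Q_def component_def
  proof (rule the_equality)
    show "is_partition Q' \<and> (E_ideal Q' :: 'k poly2 set) = ?J"
      using Q' by (simp only: J E_ideal_eq E_mon_def)
  next
    fix R assume R: "is_partition R \<and> (E_ideal R :: 'k poly2 set) = ?J"
    then have "is_partition R" by simp
    then have "(supported (- C_mon R) :: 'k poly2 set) = E_ideal R"
      by (simp only: E_ideal_eq E_mon_def)
    also have "\<dots> = supported (- C_mon Q')" using R Q' by (simp only: J)
    finally have "(supported (- C_mon R) :: 'k poly2 set) = supported (- C_mon Q')" .
    then have "C_mon R = C_mon Q'" using supported_inject by (metis double_complement)
    then show "R = Q'" using R Q' by (intro C_mon_inject) auto
  qed
  with Q' show "is_partition Q" "C_mon Q = ?D" by simp_all
qed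

end

section \<open>The map to the component cells in coordinates\<close>

text \<open>A step at a variable goes from a degree at least \<open>n\<close> to a degree that the diagram does not
  meet, so there is no condition on the coordinates.\<close>
lemma two_level_is_nf:
  assumes "is_partition Q" "\<And>m. deg m < n \<Longrightarrow> m \<in> C_mon Q" "\<And>c. c \<in> C_mon Q \<Longrightarrow> deg c \<le> n"
    and "nf_shape Q N"
  shows "is_nf Q N"
  unfolding is_nf_def
proof (intro conjI ballI)
  fix v m c assume v: "v \<in> {var_x, var_y}" and m: "m \<in> E_mon Q" and c: "c \<in> C_mon Q"
  have "n \<le> deg m" using assms(2)[of m] m by force
  moreover have "deg v = 1" using v by auto
  ultimately have "deg c \<noteq> deg v + deg m" using assms(3)[OF c] by simp
  then show "nf_step Q N v m c" using m by (intro nf_step_trivial[OF assms(1,4)]) auto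
qed (rule assms(4))

lemma W_space_eq: "W_space P i = (supported (V1 P i \<union> (C_mon P \<inter> monoms i)) :: 'k::field poly2 set)"
  by (simp add: W_space_def lin_span_mon)

context jordan_degree
begin

lemma lookup_s_lin:
  fixes f :: "'l::field poly2"
  assumes "keys f \<subseteq> V" "m \<in> V"
  shows "lookup (s_lin T P i f) (s m) = lookup f m"
proof -
  have "lookup (s_lin T P i f) (s m) = (\<Sum>u\<in>keys f. if u = m then lookup f m else 0)"
    unfolding s_lin_def lookup_sum
  proof (rule sum.cong)
    fix u assume "u \<in> keys f"
    then have "u \<in> V" using assms(1) by blast
    then show "lookup (single (s u) (lookup f u)) (s m) = (if u = m then lookup f m else 0)"
      using s_inj[of u m] assms(2) by (auto simp: lookup_single when_def)
  qed simp
  then show ?thesis by (auto simp: in_keys_iff)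
qed

lemma keys_s_lin:
  fixes f :: "'l::field poly2"
  assumes "keys f \<subseteq> V"
  shows "keys (s_lin T P i f) \<subseteq> monoms n"
proof
  fix w assume w: "w \<in> keys (s_lin T P i f)"
  have "\<exists>u\<in>keys f. s u = w"
  proof (rule ccontr)
    assume "\<not> ?thesis"
    then have "lookup (s_lin T P i f) w = 0"
      unfolding s_lin_def lookup_sum by (intro sum.neutral) (auto simp: lookup_single when_def)
    then show False using w by (simp add: in_keys_iff)
  qed
  then show "w \<in> monoms n" using assms s_deg by auto
qed

context
  fixes Q :: "nat list" and N :: "monom2 \<Rightarrow> monom2 \<Rightarrow> 'l::field"
  assumes Q: "is_partition Q" "C_mon Q = {m. deg m < n} \<union> s ` V2 T P i"
    and N: "is_nf P N"
begin

lemma N_shape: "nf_shape P N"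
  using N by (simp add: is_nf_def)

lemma s_V1_C: "m \<in> V1 P i \<Longrightarrow> s m \<notin> C_mon Q"
proof
  assume m: "m \<in> V1 P i" and "s m \<in> C_mon Q"
  then obtain c where c: "c \<in> V2 T P i" "s m = s c" using s_deg[of m] by (auto simp: Q)
  then have "m = c" using s_inj[of m c] m by simp
  then show False using V_disjoint m c by blast
qed

lemma s_V2_C: "c \<in> V2 T P i \<Longrightarrow> s c \<in> C_mon Q"
  by (simp add: Q)

lemma in_tails_Q:
  "(m', c') \<in> tails Q \<longleftrightarrow> (\<exists>m\<in>V1 P i. \<exists>c\<in>V2 T P i. m' = s m \<and> c' = s c \<and> snd c < snd m)"
proof
  assume "(m', c') \<in> tails Q"
  then have t: "m' \<notin> C_mon Q" "c' \<in> C_mon Q" "deg c' = deg m'" "snd c' < snd m'"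
    by (auto simp: in_tails)
  then have "n \<le> deg m'" by (auto simp: Q)
  then have "c' \<in> s ` V2 T P i" using t by (auto simp: Q)
  then obtain c where c: "c \<in> V2 T P i" "c' = s c" by blast
  then have "m' \<in> monoms n" using t s_deg by simp
  then have "m' \<in> s ` V" using s_bij by (simp add: bij_betw_def)
  then obtain m where m: "m \<in> V1 P i" "m' = s m" using t by (auto simp: Q)
  then show "\<exists>m\<in>V1 P i. \<exists>c\<in>V2 T P i. m' = s m \<and> c' = s c \<and> snd c < snd m"
    using t(4) c s_snd[of c m] by blast
next
  assume "\<exists>m\<in>V1 P i. \<exists>c\<in>V2 T P i. m' = s m \<and> c' = s c \<and> snd c < snd m"
  then show "(m', c') \<in> tails Q"
    using s_V1_C s_V2_C s_deg s_snd by (auto simp: in_tails)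
qed

text \<open>The normal forms of the component ideal: the entries of \<open>N\<close> in \<open>V\<^sub>i\<^sub>1 \<times> V\<^sub>i\<^sub>2\<close>, carried over by
  \<open>s\<close>.\<close>
definition comp_nf :: "monom2 \<Rightarrow> monom2 \<Rightarrow> 'l" where
  "comp_nf m' c' = (if m' \<in> C_mon Q then of_bool (m' = c')
     else if (m', c') \<in> tails Q then N (inv_into V s m') (inv_into V s c') else 0)"

lemma comp_nf_shape: "nf_shape Q comp_nf"
  by (simp add: nf_shape_def comp_nf_def)

lemma comp_nf_is_nf: "is_nf Q comp_nf"
proof (rule two_level_is_nf[OF Q(1) _ _ comp_nf_shape])
  show "\<And>m. deg m < n \<Longrightarrow> m \<in> C_mon Q" by (simp add: Q)
  show "\<And>c. c \<in> C_mon Q \<Longrightarrow> deg c \<le> n" using s_deg by (auto simp: Q)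
qed

lemma comp_nf_s:
  assumes "m \<in> V" "c \<in> V2 T P i"
  shows "comp_nf (s m) (s c) = N m c"
proof (cases "m \<in> V2 T P i")
  case True
  then show ?thesis
    using assms s_inj[of m c] V2_C[OF True] nf_shape_C[OF N_shape, of m c] s_V2_C[OF True]
    by (simp add: comp_nf_def)
next
  case False
  then have m: "m \<in> V1 P i" using assms by simp
  have inv: "inv_into V s (s u) = u" if "u \<in> V" for u
    using s_bij that by (simp add: bij_betw_def)
  show ?thesis
  proof (cases "snd c < snd m")
    case True
    then have "(s m, s c) \<in> tails Q" using m assms(2) by (auto simp: in_tails_Q)
    then show ?thesis using s_V1_C[OF m] inv[of m] inv[of c] assms by (simp add: comp_nf_def)
  next
    case False
    then have "(m, c) \<notin> tails P" by (simp add: in_tails)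
    moreover have "m \<notin> C_mon P" using V1_E[OF m] by simp
    ultimately have "N m c = 0" using nf_shape_E[OF N_shape, of m c] by simp
    moreover have "(s m, s c) \<notin> tails Q"
      using False s_snd[of c m] assms by (auto simp: in_tails)
    ultimately show ?thesis using s_V1_C[OF m] by (simp add: comp_nf_def)
  qed
qed

lemma nf_of_comp_nf:
  assumes "keys g \<subseteq> monoms n" "c \<in> V2 T P i"
  shows "nf_of comp_nf g (s c) = (\<Sum>m\<in>V. lookup g (s m) * N m c)"
proof -
  have "nf_of comp_nf g (s c) = (\<Sum>m'\<in>s ` V. lookup g m' * comp_nf m' (s c))"
    using assms(1) s_bij finite_V by (intro nf_of_superset) (auto simp: bij_betw_def)
  also have "\<dots> = (\<Sum>m\<in>V. lookup g (s m) * comp_nf (s m) (s c))"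
    using s_bij by (subst sum.reindex) (auto simp: bij_betw_def)
  also have "\<dots> = (\<Sum>m\<in>V. lookup g (s m) * N m c)"
    using comp_nf_s assms(2) by (intro sum.cong) auto
  finally show ?thesis .
qed

lemma supported_above_comp: "supported {m. n + 1 \<le> deg m} \<subseteq> nf_ideal comp_nf"
proof
  fix f :: "'l poly2" assume f: "f \<in> supported {m. n + 1 \<le> deg m}"
  have "comp_nf m c = 0" if "m \<in> keys f" for m c
  proof -
    have "n + 1 \<le> deg m" using f that by (auto simp: supported_def)
    then have "(m, c) \<notin> tails Q" "m \<notin> C_mon Q"
      using s_deg by (auto simp: in_tails_Q Q)
    then show ?thesis by (simp add: comp_nf_def)
  qed
  then show "f \<in> nf_ideal comp_nf" by (simp add: nf_ideal_def nf_of_keys)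
qed

text \<open>An element of \<open>W\<^sub>i\<close> has terms in \<open>V\<^sub>i\<close> and in \<open>K\<^sub>i\<close>. The latter are their own normal forms and do not
  contribute to the coefficients at \<open>V\<^sub>i\<^sub>2\<close>, so projecting them away keeps these coefficients zero.\<close>
lemma s_lin_pr1_in_comp:
  assumes f: "f \<in> nf_ideal N" "f \<in> W_space P i"
  shows "s_lin T P i (pr1 T P i f) \<in> nf_ideal comp_nf"
proof -
  let ?g = "s_lin T P i (pr1 T P i f)"
  have kf: "keys f \<subseteq> V1 P i \<union> (C_mon P \<inter> monoms i)"
    using f(2) unfolding W_space_eq by (simp add: supported_def)
  have kp: "keys (pr1 T P i f) \<subseteq> V" by (simp add: pr1_def keys_restr)
  have kg: "keys ?g \<subseteq> monoms n" by (rule keys_s_lin[OF kp])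
  have lg: "lookup ?g (s m) = lookup f m" if "m \<in> V" for m
    using lookup_s_lin[OF kp that] that by (simp add: pr1_def lookup_restr)
  have "nf_of comp_nf ?g c' = 0" for c'
  proof -
    consider "c' \<notin> C_mon Q" | "deg c' < n" | c where "c \<in> V2 T P i" "c' = s c"
      using Q(2) by blast
    then show ?thesis
    proof cases
      case 1
      then have "comp_nf m c' = 0" for m using nf_shape_outside[OF comp_nf_shape] by simp
      then show ?thesis by (simp add: nf_of_keys)
    next
      case 2
      have "comp_nf m c' = 0" if "m \<in> keys ?g" for m
      proof (rule nf_shape_deg[OF comp_nf_shape])
        have "deg m = n" using that kg by auto
        then show "deg m \<noteq> deg c'" using 2 by simp
      qed
      then show ?thesis by (simp add: nf_of_keys)
    next
      case (3 c)
      have "nf_of comp_nf ?g (s c) = (\<Sum>m\<in>V. lookup ?g (s m) * N m c)"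
        by (rule nf_of_comp_nf[OF kg 3(1)])
      also have "\<dots> = (\<Sum>m\<in>V. lookup f m * N m c)"
        using lg by (intro sum.cong) auto
      also have "\<dots> = (\<Sum>m\<in>V \<union> keys f. lookup f m * N m c)"
      proof (rule sum.mono_neutral_left)
        show "\<forall>m\<in>V \<union> keys f - V. lookup f m * N m c = 0"
        proof
          fix m assume m: "m \<in> V \<union> keys f - V"
          then have "m \<in> C_mon P" "m \<noteq> c" using kf 3(1) by auto
          then show "lookup f m * N m c = 0" by (simp add: nf_shape_C[OF N_shape])
        qed
      qed (use finite_V in auto)
      also have "\<dots> = nf_of N f c" using finite_V by (intro nf_of_superset[symmetric]) auto
      also have "\<dots> = 0" using f(1) by (simp add: nf_ideal_def)
      finally show ?thesis using 3(2) by simp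
    qed
  qed
  then show ?thesis by (simp add: nf_ideal_def)
qed

text \<open>Combine the reduced forms of the \<open>m \<in> V\<^sub>i\<^sub>1\<close> with the coefficients of \<open>g\<close> at \<open>s m\<close>. The image agrees
  with \<open>g\<close> at these monomials, and at \<open>V\<^sub>i\<^sub>2\<close> as well since the normal form of \<open>g\<close> is zero.\<close>
lemma comp_in_s_lin_pr1:
  assumes g: "g \<in> nf_ideal comp_nf" "keys g \<subseteq> monoms n"
  shows "\<exists>f \<in> nf_ideal N \<inter> W_space P i. s_lin T P i (pr1 T P i f) = g"
proof -
  have fin: "finite (V1 P i)" using finite_V by simp
  define f where "f = (\<Sum>m\<in>V1 P i. scale (lookup g (s m)) (nf_poly P N m))"
  have E: "m \<in> E_mon P" if "m \<in> V1 P i" for m using V1_E[OF that] by simp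
  have 1: "f \<in> nf_ideal N"
    unfolding f_def
    by (intro is_ideal_sum is_ideal_scale is_ideal_nf_ideal[OF N] nf_poly_in_ideal[OF N_shape] E)
  have 2: "f \<in> W_space P i"
    unfolding W_space_eq supported_def
  proof (intro CollectI subsetI)
    fix u assume u: "u \<in> keys f"
    have "\<exists>m\<in>V1 P i. u \<in> keys (nf_poly P N m)"
    proof (rule ccontr)
      assume "\<not> ?thesis"
      then have "lookup f u = 0"
        unfolding f_def lookup_sum by (intro sum.neutral) (auto simp: in_keys_iff)
      then show False using u by (simp add: in_keys_iff)
    qed
    then obtain m where m: "m \<in> V1 P i" "u \<in> keys (nf_poly P N m)" by blast
    then have "u = m \<or> (m, u) \<in> tails P" using keys_nf_poly[OF N_shape E] by blast
    then show "u \<in> V1 P i \<union> (C_mon P \<inter> monoms i)"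
      using m(1) V1_E[OF m(1)] by (auto simp: in_tails)
  qed
  have lf: "lookup f m' = lookup g (s m')" if m': "m' \<in> V" for m'
  proof -
    have l: "lookup f m' = (\<Sum>m\<in>V1 P i. lookup g (s m) * (if m' = m then 1 else - N m m'))"
      unfolding f_def lookup_sum
      by (intro sum.cong refl) (simp add: lookup_nf_poly[OF N_shape E])
    show ?thesis
    proof (cases "m' \<in> V1 P i")
      case True
      have "N m m' = 0" for m using nf_shape_outside[OF N_shape E[OF True]] .
      then have "lookup f m' = (\<Sum>m\<in>V1 P i. if m = m' then lookup g (s m') else 0)"
        unfolding l by (intro sum.cong) auto
      then show ?thesis using True fin by simp
    next
      case False
      then have c: "m' \<in> V2 T P i" using m' by simp
      have "0 = nf_of comp_nf g (s m')" using g(1) by (simp add: nf_ideal_def)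
      also have "\<dots> = (\<Sum>m\<in>V. lookup g (s m) * N m m')" by (rule nf_of_comp_nf[OF g(2) c])
      also have "\<dots> = (\<Sum>m\<in>V1 P i. lookup g (s m) * N m m') + (\<Sum>m\<in>V2 T P i. lookup g (s m) * N m m')"
        using finite_V V_disjoint by (intro sum.union_disjoint) auto
      also have "(\<Sum>m\<in>V2 T P i. lookup g (s m) * N m m') = (\<Sum>m\<in>V2 T P i. if m = m' then lookup g (s m') else 0)"
        using V2_C by (intro sum.cong) (auto simp: nf_shape_C[OF N_shape])
      also have "\<dots> = lookup g (s m')" using c finite_V by simp
      finally have "lookup g (s m') = - (\<Sum>m\<in>V1 P i. lookup g (s m) * N m m')"
        by (simp add: eq_neg_iff_add_eq_0 add.commute)
      also have "\<dots> = lookup f m'"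
        unfolding l sum_negf[symmetric] using False by (intro sum.cong) auto
      finally show ?thesis by simp
    qed
  qed
  have kp: "keys (pr1 T P i f) \<subseteq> V" by (simp add: pr1_def keys_restr)
  have "s_lin T P i (pr1 T P i f) = g"
  proof (rule poly_mapping_eqI)
    fix u
    show "lookup (s_lin T P i (pr1 T P i f)) u = lookup g u"
    proof (cases "u \<in> monoms n")
      case True
      then have "u \<in> s ` V" using s_bij by (simp add: bij_betw_def)
      then obtain m where m: "m \<in> V" "u = s m" by blast
      then show ?thesis
        using lookup_s_lin[OF kp m(1)] lf[OF m(1)] by (simp add: pr1_def lookup_restr)
    next
      case False
      then have "u \<notin> keys g" "u \<notin> keys (s_lin T P i (pr1 T P i f))"
        using g(2) keys_s_lin[OF kp] by blast+
      then show ?thesis by (simp add: in_keys_iff)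
    qed
  qed
  with 1 2 show ?thesis by blast
qed

lemma pi_component_nf_ideal: "pi_component T P i (nf_ideal N) = nf_ideal comp_nf"
proof
  let ?G = "s_lin T P i ` pr1 T P i ` (nf_ideal N \<inter> W_space P i)"
  have id: "is_ideal (nf_ideal comp_nf)" by (rule is_ideal_nf_ideal[OF comp_nf_is_nf])
  have "?G \<subseteq> nf_ideal comp_nf" using s_lin_pr1_in_comp by auto
  then have G: "ideal_gen ?G \<subseteq> nf_ideal comp_nf" using id by (intro idl.span_minimal)
  show "pi_component T P i (nf_ideal N) \<subseteq> nf_ideal comp_nf"
  proof
    fix f assume "f \<in> pi_component T P i (nf_ideal N)"
    then obtain a b where "f = a + b" "a \<in> ideal_gen ?G" "b \<in> supported {m. n + 1 \<le> deg m}"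
      unfolding pi_component_def ideal_power_max_ideal by (auto elim: set_plus_elim)
    then show "f \<in> nf_ideal comp_nf"
      using G supported_above_comp id by (auto simp: is_ideal_iff)
  qed
  show "nf_ideal comp_nf \<subseteq> pi_component T P i (nf_ideal N)"
  proof
    fix f assume f: "f \<in> nf_ideal comp_nf"
    let ?g = "restr (monoms n) f" and ?h = "restr {m. n + 1 \<le> deg m} f"
    have "lookup f c = 0" if c: "deg c < n" for c
    proof -
      have "comp_nf m c = of_bool (m = c)" for m
      proof (cases "deg m = deg c")
        case True
        then have "m \<in> C_mon Q" using c by (simp add: Q)
        then show ?thesis by (simp add: comp_nf_def)
      qed (auto simp: nf_shape_deg[OF comp_nf_shape])
      then have "nf_of comp_nf f c = (\<Sum>m\<in>keys f. if m = c then lookup f c else 0)"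
        unfolding nf_of_keys by (intro sum.cong) auto
      also have "\<dots> = lookup f c" by (auto simp: in_keys_iff)
      finally show ?thesis using f by (simp add: nf_ideal_def)
    qed
    then have "f = ?g + ?h"
      by (intro poly_mapping_eqI) (auto simp: lookup_add lookup_restr not_less_eq_eq)
    moreover have "?g \<in> nf_ideal comp_nf"
      using graded_nf_ideal[OF comp_nf_is_nf] f by (simp add: graded_ideal_def)
    then have "?g \<in> ?G" using comp_in_s_lin_pr1[of ?g] by (force simp: keys_restr)
    then have "?g \<in> ideal_gen ?G" by (rule idl.span_base)
    moreover have "?h \<in> ideal_power max_ideal (n + 1)"
      unfolding ideal_power_max_ideal by (auto simp: supported_def keys_restr)
    ultimately show "f \<in> pi_component T P i (nf_ideal N)"
      unfolding pi_component_def by (metis set_plus_intro)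
  qed
qed

end

text \<open>The map to a component forgets all coordinates except those indexed by \<open>V\<^sub>i\<^sub>1 \<times> V\<^sub>i\<^sub>2\<close>.\<close>
lemma pi_component_coord:
  fixes I :: "'l::field poly2 set"
  defines "Q \<equiv> component TYPE('k::field) T P i"
  assumes "I \<in> jordan_cell P"
  shows "pi_component T P i I \<in> jordan_cell Q"
    and "\<And>m c. m \<in> V1 P i \<Longrightarrow> c \<in> V2 T P i \<Longrightarrow> snd c < snd m \<Longrightarrow>
      cell_coord Q (pi_component T P i I) (s m, s c) = cell_coord P I (m, c)"
proof -
  note Q = component[where 'k = 'k, folded Q_def]
  let ?N = "cell_nf P I"
  have N: "is_nf P ?N" by (rule is_nf_cell_nf[OF partition assms(2)])
  have pi: "pi_component T P i I = nf_ideal (comp_nf Q ?N)"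
    using pi_component_nf_ideal[OF Q N] cell_eq_nf_ideal[OF partition assms(2)] by simp
  have nf: "is_nf Q (comp_nf Q ?N)" by (rule comp_nf_is_nf[OF Q N])
  show "pi_component T P i I \<in> jordan_cell Q"
    unfolding pi by (rule nf_ideal_in_cell[OF Q(1) nf])
  fix m c assume a: "m \<in> V1 P i" "c \<in> V2 T P i" "snd c < snd m"
  then have "(s m, s c) \<in> tails Q" using in_tails_Q[OF Q N] by blast
  then have "cell_coord Q (pi_component T P i I) (s m, s c) = - comp_nf Q ?N (s m) (s c)"
    unfolding pi cell_coord_nf_ideal[OF Q(1) nf] by simp
  also have "comp_nf Q ?N (s m) (s c) = ?N m c" using a by (intro comp_nf_s[OF Q N]) auto
  also have "- ?N m c = cell_coord P I (m, c)" using V1_E[OF a(1)] by (simp add: cell_nf_def)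
  finally show "cell_coord Q (pi_component T P i I) (s m, s c) = cell_coord P I (m, c)" .
qed

end

section \<open>Evaluation of polynomials\<close>

lemma prod_power_keys_add:
  fixes z :: "'v \<Rightarrow> 'l::comm_semiring_1"
  shows "(\<Prod>v\<in>keys (a + b). z v ^ lookup (a + b) v) =
    (\<Prod>v\<in>keys a. z v ^ lookup a v) * (\<Prod>v\<in>keys b. z v ^ lookup b v)"
proof -
  let ?S = "keys a \<union> keys b"
  have "(\<Prod>v\<in>keys u. z v ^ lookup u v) = (\<Prod>v\<in>?S. z v ^ lookup u v)" if "keys u \<subseteq> ?S" for u
    using that by (intro prod.mono_neutral_left) (auto simp: in_keys_iff)
  from this[of a] this[of b] this[of "a + b"] show ?thesis
    using Poly_Mapping.keys_add[of a b] by (simp add: lookup_add power_add prod.distrib)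
qed

lemma eval_mpoly_linear_ext:
  "eval_mpoly \<phi> p z = linear_ext \<phi> (\<lambda>u. \<Prod>v\<in>keys u. z v ^ lookup u v) p"
  by (simp add: eval_mpoly_def linear_ext_def)

lemma ring_map_eval_mpoly:
  assumes "ring_map \<phi>"
  shows "ring_map (\<lambda>p. eval_mpoly \<phi> p z)"
  unfolding ring_map_def
proof (intro conjI allI)
  have "eval_mpoly \<phi> (single 0 1) z = \<phi> 1"
    unfolding eval_mpoly_linear_ext linear_ext_single[OF assms] by simp
  then show "eval_mpoly \<phi> 1 z = 1" using assms by (simp add: ring_map_def)
  show "eval_mpoly \<phi> (p + q) z = eval_mpoly \<phi> p z + eval_mpoly \<phi> q z" for p q
    unfolding eval_mpoly_linear_ext by (rule linear_ext_add[OF assms])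
  show "eval_mpoly \<phi> (p * q) z = eval_mpoly \<phi> p z * eval_mpoly \<phi> q z" for p q
    unfolding eval_mpoly_linear_ext by (rule linear_ext_mult[OF assms prod_power_keys_add])
qed

definition mvar :: "'v \<Rightarrow> ('v, 'k::field) mpoly" where
  "mvar v = single (single v 1) 1"

lemma eval_mvar: "ring_map \<phi> \<Longrightarrow> eval_mpoly \<phi> (mvar v) z = z v"
  unfolding eval_mpoly_linear_ext mvar_def
  by (subst linear_ext_single) (simp_all add: ring_map_def)

section \<open>The isomorphism\<close>

theorem theorem2p27:
  fixes \<phi> :: "'k::field \<Rightarrow> 'l::field" and T :: "nat \<Rightarrow> nat" and d j :: nat and P :: "nat list"
  assumes "field_embedding \<phi>"
    and "0 < d" and "d \<le> j + 1"
    and "\<And>i. i < d \<Longrightarrow> T i = i + 1"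
    and "T d \<le> d"
    and "\<And>i. d \<le> i \<Longrightarrow> i < j \<Longrightarrow> T (i + 1) \<le> T i"
    and "0 < T j"
    and "\<And>i. j < i \<Longrightarrow> T i = 0"
    and "is_partition P"
    and "\<And>i. hilbert_function (E_ideal P :: 'k poly2 set) i = T i"
  defines "Q \<equiv> component TYPE('k) T P"
  shows "isomorphism_over \<phi>
           (jordan_cell P :: 'l poly2 set set) (cell_coord P)
           (\<Pi>\<^sub>E i\<in>{d..j}. jordan_cell (Q i)) (prod_coord {d..j} Q)
           (\<lambda>I. \<lambda>i\<in>{d..j}. pi_component T P i I)"
proof -
  have \<phi>: "ring_map \<phi>" using assms(1) by (simp add: ring_map_def field_embedding_def)
  have T: "T i = card (C_mon P \<inter> monoms i)" for i
    using assms(10)[of i] hilbert_function_E_ideal[OF assms(9), where 'k = 'k] by simp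
  have T_pos: "0 < T i" if "d \<le> i" "i \<le> j" for i
    using that(2,1)
  proof (induction i rule: inc_induct)
    case (step i)
    then show ?case using assms(6)[of i] by simp
  qed (rule assms(7))
  have deg_loc: "jordan_degree P T i" if i: "i \<in> {d..j}" for i
  proof
    show "is_partition P" by fact
    show "T i = card (C_mon P \<inter> monoms i)" for i by (rule T)
    show "0 < i" using i assms(2) by simp
    show "0 < T i" using i by (simp add: T_pos)
    show "T i \<le> T (i - 1)"
    proof (cases "i = d")
      case True
      then show ?thesis using assms(4)[of "d - 1"] assms(2,5) by simp
    next
      case False
      then have "i - 1 + 1 = i" "d \<le> i - 1" "i - 1 < j" using i assms(2) by auto
      then show ?thesis using assms(6)[of "i - 1"] by simp
    qed
    show "T (i + 1) \<le> T i"
    proof (cases "i = j")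
      case True
      then show ?thesis using assms(8)[of "i + 1"] by simp
    next
      case False
      then show ?thesis using assms(6)[of i] i by simp
    qed
  qed
  have free_deg: "deg m \<in> {d..j}" if f: "(m, c) \<in> free_tails P" for m c
  proof -
    have t: "m \<notin> C_mon P" "c \<in> C_mon P" "deg c = deg m"
      using f by (auto simp: free_tails_def in_tails)
    have "T (deg m) \<noteq> 0" unfolding T using t by (auto simp: card_eq_0_iff)
    then have "deg m \<le> j" using assms(8)[of "deg m"] by force
    moreover have "d \<le> deg m"
    proof (rule ccontr)
      assume "\<not> d \<le> deg m"
      then have "card (C_mon P \<inter> monoms (deg m)) = card (monoms (deg m))"
        using assms(4)[of "deg m"] by (simp add: T card_monoms)
      then have "C_mon P \<inter> monoms (deg m) = monoms (deg m)"
        by (intro card_subset_eq) auto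
      moreover have "m \<in> monoms (deg m)" by simp
      ultimately show False using t(1) by blast
    qed
    ultimately show ?thesis by simp
  qed
  let ?s = "s_map T P" and ?S = "{d..j}"
  let ?X = "jordan_cell P :: 'l poly2 set set"
  let ?Y = "(\<Pi>\<^sub>E i\<in>?S. jordan_cell (Q i)) :: (nat \<Rightarrow> 'l poly2 set) set"
  define f where "f = (\<lambda>I :: 'l poly2 set. \<lambda>i\<in>?S. pi_component T P i I)"
  \<comment> \<open>The coordinate of the product of the component cells at which a free entry is recorded, and
      the free entries recorded by a point of the product.\<close>
  define index :: "monom2 \<times> monom2 \<Rightarrow> nat \<times> (monom2 \<times> monom2)"
    where "index = (\<lambda>(m, c). (deg m, (?s (deg m) m, ?s (deg m) c)))"
  define l where "l = (\<lambda>J :: nat \<Rightarrow> 'l poly2 set. \<lambda>w. prod_coord ?S Q J (index w))"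

  have part: "is_partition (Q i)" if "i \<in> ?S" for i
    unfolding Q_def by (rule jordan_degree.component(1)[OF deg_loc[OF that]])
  have tailsQ: "\<exists>m c. (m, c) \<in> free_tails P \<and> deg m = i \<and> m' = ?s i m \<and> c' = ?s i c"
    if i: "i \<in> ?S" and t: "(m', c') \<in> tails (Q i)" for i m' c'
  proof -
    interpret jordan_degree P T i by (rule deg_loc[OF i])
    \<comment> \<open>The index pairs do not depend on the normal form system from which the component is
        formed, so any one will do here.\<close>
    obtain m c where mc: "m \<in> V1 P i" "c \<in> V2 T P i" "m' = s m" "c' = s c" "snd c < snd m"
      using t in_tails_Q[OF component[where 'k = 'k] is_nf_solution[OF partition, where l = "\<lambda>_. 0 :: 'l"]]
      unfolding Q_def by blast
    moreover have "deg m = i" using V1_E[OF mc(1)] by simp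
    ultimately show ?thesis using free_tails_eq by blast
  qed
  have coord: "cell_coord (Q i) (pi_component T P i I) (?s i m, ?s i c) = cell_coord P I (m, c)"
    if I: "I \<in> ?X" and f: "(m, c) \<in> free_tails P" and i: "deg m = i" for I m c i
  proof -
    have "i \<in> ?S" using free_deg[OF f] i by simp
    then interpret jordan_degree P T i by (rule deg_loc)
    show ?thesis
      using free_tails_eq[OF i] f pi_component_coord(2)[OF I, where 'k = 'k] unfolding Q_def by blast
  qed
  have maps: "f I \<in> ?Y" if I: "I \<in> ?X" for I
    unfolding f_def Q_def using jordan_degree.pi_component_coord(1)[OF deg_loc I, where 'k = 'k] by simp
  have l_f: "l (f I) (m, c) = cell_coord P I (m, c)" if "I \<in> ?X" "(m, c) \<in> free_tails P" for I m c
    using coord[OF that refl] free_deg[OF that(2)] by (simp add: l_def index_def prod_coord_def f_def)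
  have nf_f: "cell_nf P I = nf_solution P (l (f I))" if I: "I \<in> ?X" for I
  proof (intro ext nf_solution_unique[OF assms(9) is_nf_cell_nf[OF assms(9) I]])
    fix m c assume mc: "(m, c) \<in> free_tails P"
    then have "m \<notin> C_mon P" by (simp add: free_tails_def in_tails)
    then show "cell_nf P I m c = - l (f I) (m, c)" using l_f[OF I mc] by (simp add: cell_nf_def)
  qed
  have inj: "inj_on f ?X"
  proof (rule inj_onI)
    fix I I' assume I: "I \<in> ?X" "I' \<in> ?X" "f I = f I'"
    then have "cell_nf P I = cell_nf P I'" using nf_f by simp
    then show "I = I'" using I cell_eq_nf_ideal[OF assms(9)] by metis
  qed
  have surj: "\<exists>I\<in>?X. f I = J" if J: "J \<in> ?Y" for J
  proof
    let ?N = "nf_solution P (l J)"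
    have N: "is_nf P ?N" by (rule is_nf_solution[OF assms(9)])
    show I: "nf_ideal ?N \<in> ?X" by (rule nf_ideal_in_cell[OF assms(9) N])
    have "pi_component T P i (nf_ideal ?N) = J i" if i: "i \<in> ?S" for i
    proof (rule cell_coord_inject[OF part[OF i]])
      show "J i \<in> jordan_cell (Q i)" using J i by auto
      show "pi_component T P i (nf_ideal ?N) \<in> jordan_cell (Q i)"
        using maps[OF I] i by (auto simp: f_def dest: PiE_mem)
      fix m' c' assume "(m', c') \<in> tails (Q i)"
      then obtain m c where mc: "(m, c) \<in> free_tails P" "deg m = i" "m' = ?s i m" "c' = ?s i c"
        using tailsQ[OF i] by blast
      have "cell_coord (Q i) (pi_component T P i (nf_ideal ?N)) (m', c') = cell_coord P (nf_ideal ?N) (m, c)"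
        using coord[OF I mc(1,2)] mc by simp
      also have "\<dots> = l J (m, c)"
        using mc(1) nf_solution_free[OF mc(1), of "l J"]
        by (simp add: cell_coord_nf_ideal[OF assms(9) N] free_tails_def)
      also have "\<dots> = cell_coord (Q i) (J i) (m', c')"
        using mc i by (simp add: l_def index_def prod_coord_def)
      finally show "cell_coord (Q i) (pi_component T P i (nf_ideal ?N)) (m', c') = cell_coord (Q i) (J i) (m', c')" .
    qed
    then show "f (nf_ideal ?N) = J"
      using J by (intro PiE_ext[OF maps[OF I] J]) (simp add: f_def)
  qed
  have bij: "bij_betw f ?X ?Y"
    unfolding bij_betw_def using inj maps surj by blast

  have forward: "morphism_over \<phi> ?X (cell_coord P) ?Y (prod_coord ?S Q) f"
    unfolding morphism_over_def
  proof (intro conjI exI ballI allI)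
    show "f ` ?X \<subseteq> ?Y" using maps by blast
    \<comment> \<open>Every coordinate of the product is a copy of a free entry; select one.\<close>
    define pre where "pre = (\<lambda>i m' c'. SOME w. fst w \<in> monoms i \<and> w \<in> free_tails P \<and> m' = ?s i (fst w) \<and> c' = ?s i (snd w))"
    define F :: "nat \<times> (monom2 \<times> monom2) \<Rightarrow> (monom2 \<times> monom2, 'k) mpoly"
      where "F = (\<lambda>(i, (m', c')). if i \<in> ?S \<and> (m', c') \<in> tails (Q i) then mvar (pre i m' c') else 0)"
    fix I :: "'l poly2 set" and w :: "nat \<times> (monom2 \<times> monom2)" assume I: "I \<in> ?X"
    obtain i m' c' where w: "w = (i, (m', c'))" by (cases w) auto
    show "prod_coord ?S Q (f I) w = eval_mpoly \<phi> (F w) (cell_coord P I)"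
    proof (cases "i \<in> ?S \<and> (m', c') \<in> tails (Q i)")
      case True
      then obtain m c where "(m, c) \<in> free_tails P" "deg m = i" "m' = ?s i m" "c' = ?s i c"
        using tailsQ by blast
      then have "\<exists>w. fst w \<in> monoms i \<and> w \<in> free_tails P \<and> m' = ?s i (fst w) \<and> c' = ?s i (snd w)"
        by (intro exI[of _ "(m, c)"]) simp
      then have p: "fst (pre i m' c') \<in> monoms i \<and> pre i m' c' \<in> free_tails P
          \<and> m' = ?s i (fst (pre i m' c')) \<and> c' = ?s i (snd (pre i m' c'))"
        unfolding pre_def by (rule someI_ex)
      obtain m c where mc: "pre i m' c' = (m, c)" by (cases "pre i m' c'")
      have "prod_coord ?S Q (f I) w = cell_coord (Q i) (pi_component T P i I) (m', c')"
        using True by (simp add: w prod_coord_def f_def)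
      also have "\<dots> = cell_coord P I (m, c)"
        using coord[OF I, of m c i] p by (simp add: mc)
      also have "\<dots> = eval_mpoly \<phi> (F w) (cell_coord P I)"
        using True by (simp add: w F_def eval_mvar[OF \<phi>] mc)
      finally show ?thesis .
    next
      case False
      then have "prod_coord ?S Q (f I) w = 0"
        by (auto simp: w prod_coord_def cell_coord_eq)
      moreover have "eval_mpoly \<phi> (F w) (cell_coord P I) = 0"
        using False by (auto simp: w F_def eval_mpoly_def)
      ultimately show ?thesis by simp
    qed
  qed

  have backward: "morphism_over \<phi> ?Y (prod_coord ?S Q) ?X (cell_coord P) (inv_into ?X f)"
    unfolding morphism_over_def
  proof (intro conjI exI ballI allI)
    show "inv_into ?X f ` ?Y \<subseteq> ?X" using bij_betw_inv_into[OF bij] by (simp add: bij_betw_def)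
    \<comment> \<open>The recursion, carried out with the coordinates of the product as indeterminates.\<close>
    define F :: "monom2 \<times> monom2 \<Rightarrow> (nat \<times> (monom2 \<times> monom2), 'k) mpoly"
      where "F = (\<lambda>(m, c). if (m, c) \<in> tails P then - nf_solution P (\<lambda>w. mvar (index w)) m c else 0)"
    fix J :: "nat \<Rightarrow> 'l poly2 set" and w :: "monom2 \<times> monom2" assume J: "J \<in> ?Y"
    obtain m c where w: "w = (m, c)" by (cases w)
    let ?I = "inv_into ?X f J"
    have I: "?I \<in> ?X" using bij_betwE[OF bij_betw_inv_into[OF bij]] J by blast
    have fI: "f ?I = J" using bij J by (simp add: bij_betw_inv_into_right)
    let ?ev = "\<lambda>p. eval_mpoly \<phi> p (prod_coord ?S Q J)"
    have ev: "ring_map ?ev" by (rule ring_map_eval_mpoly[OF \<phi>])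
    show "cell_coord P ?I w = ?ev (F w)"
    proof (cases "(m, c) \<in> tails P")
      case True
      then have "m \<notin> C_mon P" by (simp add: in_tails)
      then have "cell_coord P ?I (m, c) = - cell_nf P ?I m c" by (simp add: cell_nf_def)
      also have "\<dots> = - nf_solution P (l J) m c" using nf_f[OF I] by (simp add: fI)
      also have "l J = (\<lambda>w. ?ev (mvar (index w)))" by (simp add: l_def eval_mvar[OF \<phi>])
      also have "nf_solution P \<dots> m c = ?ev (nf_solution P (\<lambda>w. mvar (index w)) m c)"
        by (rule nf_solution_hom[OF ev, symmetric])
      also have "- \<dots> = ?ev (F w)"
        using True ring_map_minus[OF ev] by (simp add: w F_def)
      finally show ?thesis by (simp add: w)
    next
      case False
      then show ?thesis by (simp add: w F_def eval_mpoly_def cell_coord_eq)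
    qed
  qed
  show ?thesis
    using bij forward backward unfolding isomorphism_over_def f_def by blast
qed

end
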